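(* Let $k$ be a field of characteristic $\neq 2$ and let $A=(A,\cdot)$ and $V=(V,\cdot_V)$ be two Jordan algebras over $k$. Then: (1) The relation $\approx$ on pairs $(\triangleright,f)$ (defined in the context) is an equivalence relation on the set $\mathcal{CP}(A,V)$ of all crossed systems of $A$ and $V$. Denote the quotient set by $\mathrm{H}^2_{\rm nab}(V,A):=\mathcal{CP}(A,V)/\approx$. (2) The map $$\mathrm{H}^2_{\rm nab}(V,A)\to\mathrm{Ext}(V,A),\qquad \overline{(\triangleright,f)}\mapsto\bigl(A\#_{\triangleright}^f V,\; i_A,\;\pi_V\bigr)$$ is (well defined and) a bijection, where $\overline{(\triangleright,f)}$ is the equivalence class of $(\triangleright,f)$ and the right-hand side denotes the class of the extension of $V$ by $A$ given by $i_A(a)=(a,0)$ and $\pi_V(a,x)=x$.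
   Context: $k$ is a field of characteristic $\neq 2$; all vector spaces and (bi)linear maps are over $k$. A Jordan algebra is a vector space $A$ with a commutative bilinear multiplication satisfying $(a^2\cdot b)\cdot a=a^2\cdot(b\cdot a)$ for all $a,b$ (no unit assumed). For Jordan algebras $A=(A,\cdot)$, $V=(V,\cdot_V)$ and bilinear maps $\triangleright:V\times A\to A$, $f:V\times V\to A$, let $A\#_{\triangleright}^fV$ be the vector space $A\times V$ with multiplication $$(a,x)\circ(b,y):=\bigl(a\cdot b+x\triangleright b+y\triangleright a+f(x,y),\;x\cdot_Vy\bigr).$$ $(A,V,\triangleright,f)$, or the pair $(\triangleright,f)$, is a crossed system if for all $a,b\in A$, $x,y\in V$ (with $a^2=a\cdot a$, $x^2=x\cdot_Vx$): (CP1) $f$ is symmetric; (CP2) $a\cdot(x\triangleright a^2)=a^2\cdot(x\triangleright a)$; (CP3) $x\triangleright(f(x,x)\cdot a)+x\triangleright(x^2\triangleright a)=f(x,x)\cdot(x\triangleright a)+x^2\triangleright(x\triangleright a)$; (CP4) $x\triangleright(y\triangleright f(x,x))+x\triangleright f(x^2,y)+f(x^2\cdot_Vy,x)=f(x,x)\cdot f(x,y)+x^2\triangleright f(x,y)+(x\cdot_Vy)\triangleright f(x,x)+f(x^2,x\cdot_Vy)$; (CP5) in $(A\times V,\circ)$, identifying $a=(a,0)$, $x=(0,x)$, one has $P(a,b,x)+P(x,b,a)+P(a,y,x)+P(x,y,a)=0$, where $P(X,Y,Z):=(X\circ X,Y,Z)+2(X\circ Z,Y,X)$ and $(X,Y,Z):=(X\circ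 Y)\circ Z-X\circ(Y\circ Z)$ is the associator. (These conditions are those under which $(A\times V,\circ)$ is a Jordan algebra, then called the crossed product of $A$ and $V$.) $\mathcal{CP}(A,V)$ is the set of pairs $(\triangleright,f)$ satisfying (CP1)–(CP5). Two pairs $(\triangleright,f),(\triangleright',f')\in\mathcal{CP}(A,V)$ are cohomologous, $(\triangleright,f)\approx(\triangleright',f')$, if there is a linear map $r:V\to A$ such that for all $a\in A$, $x,y\in V$: $$x\triangleright'a=x\triangleright a-a\cdot r(x),\qquad f'(x,y)=f(x,y)+r(x\cdot_Vy)+r(x)\cdot r(y)-x\triangleright r(y)-y\triangleright r(x).$$ An extension of $V$ by $A$ is a triple $(E,i,p)$ with $E$ a Jordan algebra and $i:A\to E$, $p:E\to V$ Jordan algebra morphisms such that $0\to A\xrightarrow{i}E\xrightarrow{p}V\to0$ is exact. Two extensions $(E,i,p)$, $(E',i',p')$ are cohomologous if there is a Jordan algebra morphism $\varphi:E\to E'$ with $\varphi\circ i=i'$ and $p'\circ\varphi=p$. $\mathrm{Ext}(V,A)$ is the set of equivalence classes of extensions of $V$ by $A$ under this relation. *)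

theory Defs
  imports "HOL-Algebra.Module" "HOL-Algebra.AbelCoset"
begin

definition ring_characteristic :: "('k, 'r) ring_scheme \<Rightarrow> nat" where
  "ring_characteristic K =
     (if \<exists>n::nat. 0 < n \<and> add_pow K n \<one>\<^bsub>K\<^esub> = \<zero>\<^bsub>K\<^esub>
      then LEAST n::nat. 0 < n \<and> add_pow K n \<one>\<^bsub>K\<^esub> = \<zero>\<^bsub>K\<^esub> else 0)"

text \<open>
  A nonassociative algebra is carried by the record type \<open>module\<close>: its field \<open>mult\<close>, on which the
  locale \<open>module\<close> imposes nothing, is the multiplication. The field \<open>one\<close> of that record is never
  used; no unit is assumed.
\<close>

locale jordan_algebra = module K J + field K for K (structure) and J (structure) +
  assumes mult_closed: "\<lbrakk>a \<in> carrier J; b \<in> carrier J\<rbrakk> \<Longrightarrow> a \<otimes>\<^bsub>J\<^esub> b \<in> carrier J"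
    and mult_commute: "\<lbrakk>a \<in> carrier J; b \<in> carrier J\<rbrakk> \<Longrightarrow> a \<otimes>\<^bsub>J\<^esub> b = b \<otimes>\<^bsub>J\<^esub> a"
    and mult_add_left: "\<lbrakk>a \<in> carrier J; b \<in> carrier J; c \<in> carrier J\<rbrakk>
          \<Longrightarrow> (a \<oplus>\<^bsub>J\<^esub> b) \<otimes>\<^bsub>J\<^esub> c = a \<otimes>\<^bsub>J\<^esub> c \<oplus>\<^bsub>J\<^esub> b \<otimes>\<^bsub>J\<^esub> c"
    and mult_smult_left: "\<lbrakk>t \<in> carrier K; a \<in> carrier J; b \<in> carrier J\<rbrakk>
          \<Longrightarrow> (t \<odot>\<^bsub>J\<^esub> a) \<otimes>\<^bsub>J\<^esub> b = t \<odot>\<^bsub>J\<^esub> (a \<otimes>\<^bsub>J\<^esub> b)"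
    and jordan_identity: "\<lbrakk>a \<in> carrier J; b \<in> carrier J\<rbrakk>
          \<Longrightarrow> ((a \<otimes>\<^bsub>J\<^esub> a) \<otimes>\<^bsub>J\<^esub> b) \<otimes>\<^bsub>J\<^esub> a = (a \<otimes>\<^bsub>J\<^esub> a) \<otimes>\<^bsub>J\<^esub> (b \<otimes>\<^bsub>J\<^esub> a)"

definition linear_maps ::
  "('k, 'r) ring_scheme \<Rightarrow> ('k, 'm) module \<Rightarrow> ('k, 'n) module \<Rightarrow> ('m \<Rightarrow> 'n) set" where
  "linear_maps K M N = {h. h \<in> carrier M \<rightarrow> carrier N
     \<and> (\<forall>x\<in>carrier M. \<forall>y\<in>carrier M. h (x \<oplus>\<^bsub>M\<^esub> y) = h x \<oplus>\<^bsub>N\<^esub> h y)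
     \<and> (\<forall>t\<in>carrier K. \<forall>x\<in>carrier M. h (t \<odot>\<^bsub>M\<^esub> x) = t \<odot>\<^bsub>N\<^esub> h x)}"

text \<open>Bilinear maps are extensional, so that they are determined by their values on the carriers.\<close>

definition bilinear_maps ::
  "('k, 'r) ring_scheme \<Rightarrow> ('k, 'm) module \<Rightarrow> ('k, 'n) module \<Rightarrow> ('k, 'p) module
    \<Rightarrow> ('m \<times> 'n \<Rightarrow> 'p) set" where
  "bilinear_maps K M N P = {h. h \<in> carrier M \<times> carrier N \<rightarrow>\<^sub>E carrier P
     \<and> (\<forall>x\<in>carrier M. (\<lambda>y. h (x, y)) \<in> linear_maps K N P)
     \<and> (\<forall>y\<in>carrier N. (\<lambda>x. h (x, y)) \<in> linear_maps K M P)}"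

definition jordan_morphisms ::
  "('k, 'r) ring_scheme \<Rightarrow> ('k, 'm) module \<Rightarrow> ('k, 'n) module \<Rightarrow> ('m \<Rightarrow> 'n) set" where
  "jordan_morphisms K M N = {h \<in> linear_maps K M N.
     \<forall>x\<in>carrier M. \<forall>y\<in>carrier M. h (x \<otimes>\<^bsub>M\<^esub> y) = h x \<otimes>\<^bsub>N\<^esub> h y}"

definition associator :: "('k, 'm) module \<Rightarrow> 'm \<Rightarrow> 'm \<Rightarrow> 'm \<Rightarrow> 'm" where
  "associator E u v w = (u \<otimes>\<^bsub>E\<^esub> v) \<otimes>\<^bsub>E\<^esub> w \<ominus>\<^bsub>E\<^esub> u \<otimes>\<^bsub>E\<^esub> (v \<otimes>\<^bsub>E\<^esub> w)"

definition jordan_P :: "('k, 'm) module \<Rightarrow> 'm \<Rightarrow> 'm \<Rightarrow> 'm \<Rightarrow> 'm" where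
  "jordan_P E u v w =
     associator E (u \<otimes>\<^bsub>E\<^esub> u) v w \<oplus>\<^bsub>E\<^esub> add_pow E (2::nat) (associator E (u \<otimes>\<^bsub>E\<^esub> w) v u)"

text \<open>In a pair \<open>(r, f)\<close> of bilinear maps, \<open>r (x, a)\<close> stands for the action of \<open>x\<close> on \<open>a\<close>.\<close>

definition crossed_product ::
  "('k, 'a) module \<Rightarrow> ('k, 'v) module \<Rightarrow> ('v \<times> 'a \<Rightarrow> 'a) \<Rightarrow> ('v \<times> 'v \<Rightarrow> 'a)
    \<Rightarrow> ('k, 'a \<times> 'v) module" where
  "crossed_product A V r f =
     \<lparr>carrier = carrier A \<times> carrier V,
      mult = (\<lambda>(a, x) (b, y).
        (a \<otimes>\<^bsub>A\<^esub> b \<oplus>\<^bsub>A\<^esub> r (x, b) \<oplus>\<^bsub>A\<^esub> r (y, a) \<oplus>\<^bsub>A\<^esub> f (x, y), x \<otimes>\<^bsub>V\<^esub> y)),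
      one = undefined,
      zero = (\<zero>\<^bsub>A\<^esub>, \<zero>\<^bsub>V\<^esub>),
      add = (\<lambda>(a, x) (b, y). (a \<oplus>\<^bsub>A\<^esub> b, x \<oplus>\<^bsub>V\<^esub> y)),
      smult = (\<lambda>t (a, x). (t \<odot>\<^bsub>A\<^esub> a, t \<odot>\<^bsub>V\<^esub> x))\<rparr>"

definition CP1 :: "('k, 'v) module \<Rightarrow> ('v \<times> 'v \<Rightarrow> 'a) \<Rightarrow> bool" where
  "CP1 V f \<longleftrightarrow> (\<forall>x\<in>carrier V. \<forall>y\<in>carrier V. f (x, y) = f (y, x))"

definition CP2 :: "('k, 'a) module \<Rightarrow> ('k, 'v) module \<Rightarrow> ('v \<times> 'a \<Rightarrow> 'a) \<Rightarrow> bool" where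
  "CP2 A V r \<longleftrightarrow> (\<forall>a\<in>carrier A. \<forall>x\<in>carrier V.
     a \<otimes>\<^bsub>A\<^esub> r (x, a \<otimes>\<^bsub>A\<^esub> a) = (a \<otimes>\<^bsub>A\<^esub> a) \<otimes>\<^bsub>A\<^esub> r (x, a))"

definition CP3 ::
  "('k, 'a) module \<Rightarrow> ('k, 'v) module \<Rightarrow> ('v \<times> 'a \<Rightarrow> 'a) \<Rightarrow> ('v \<times> 'v \<Rightarrow> 'a) \<Rightarrow> bool" where
  "CP3 A V r f \<longleftrightarrow> (\<forall>a\<in>carrier A. \<forall>x\<in>carrier V.
     r (x, f (x, x) \<otimes>\<^bsub>A\<^esub> a) \<oplus>\<^bsub>A\<^esub> r (x, r (x \<otimes>\<^bsub>V\<^esub> x, a))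
     = f (x, x) \<otimes>\<^bsub>A\<^esub> r (x, a) \<oplus>\<^bsub>A\<^esub> r (x \<otimes>\<^bsub>V\<^esub> x, r (x, a)))"

definition CP4 ::
  "('k, 'a) module \<Rightarrow> ('k, 'v) module \<Rightarrow> ('v \<times> 'a \<Rightarrow> 'a) \<Rightarrow> ('v \<times> 'v \<Rightarrow> 'a) \<Rightarrow> bool" where
  "CP4 A V r f \<longleftrightarrow> (\<forall>x\<in>carrier V. \<forall>y\<in>carrier V.
     r (x, r (y, f (x, x))) \<oplus>\<^bsub>A\<^esub> r (x, f (x \<otimes>\<^bsub>V\<^esub> x, y)) \<oplus>\<^bsub>A\<^esub> f ((x \<otimes>\<^bsub>V\<^esub> x) \<otimes>\<^bsub>V\<^esub> y, x)
     = f (x, x) \<otimes>\<^bsub>A\<^esub> f (x, y) \<oplus>\<^bsub>A\<^esub> r (x \<otimes>\<^bsub>V\<^esub> x, f (x, y))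
       \<oplus>\<^bsub>A\<^esub> r (x \<otimes>\<^bsub>V\<^esub> y, f (x, x)) \<oplus>\<^bsub>A\<^esub> f (x \<otimes>\<^bsub>V\<^esub> x, x \<otimes>\<^bsub>V\<^esub> y))"

definition CP5 ::
  "('k, 'a) module \<Rightarrow> ('k, 'v) module \<Rightarrow> ('v \<times> 'a \<Rightarrow> 'a) \<Rightarrow> ('v \<times> 'v \<Rightarrow> 'a) \<Rightarrow> bool" where
  "CP5 A V r f \<longleftrightarrow>
     (let E = crossed_product A V r f; inA = (\<lambda>a. (a, \<zero>\<^bsub>V\<^esub>)); inV = (\<lambda>x. (\<zero>\<^bsub>A\<^esub>, x)) in
      \<forall>a\<in>carrier A. \<forall>b\<in>carrier A. \<forall>x\<in>carrier V. \<forall>y\<in>carrier V.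
        jordan_P E (inA a) (inA b) (inV x) \<oplus>\<^bsub>E\<^esub> jordan_P E (inV x) (inA b) (inA a)
        \<oplus>\<^bsub>E\<^esub> jordan_P E (inA a) (inV y) (inV x) \<oplus>\<^bsub>E\<^esub> jordan_P E (inV x) (inV y) (inA a) = \<zero>\<^bsub>E\<^esub>)"

definition crossed_systems ::
  "('k, 'r) ring_scheme \<Rightarrow> ('k, 'a) module \<Rightarrow> ('k, 'v) module
    \<Rightarrow> (('v \<times> 'a \<Rightarrow> 'a) \<times> ('v \<times> 'v \<Rightarrow> 'a)) set" where
  "crossed_systems K A V = {(r, f). r \<in> bilinear_maps K V A A \<and> f \<in> bilinear_maps K V V A
     \<and> CP1 V f \<and> CP2 A V r \<and> CP3 A V r f \<and> CP4 A V r f \<and> CP5 A V r f}"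

definition cohomologous_systems ::
  "('k, 'r) ring_scheme \<Rightarrow> ('k, 'a) module \<Rightarrow> ('k, 'v) module
    \<Rightarrow> ((('v \<times> 'a \<Rightarrow> 'a) \<times> ('v \<times> 'v \<Rightarrow> 'a)) \<times> (('v \<times> 'a \<Rightarrow> 'a) \<times> ('v \<times> 'v \<Rightarrow> 'a))) set" where
  "cohomologous_systems K A V = {((r, f), (r', f')).
     (r, f) \<in> crossed_systems K A V \<and> (r', f') \<in> crossed_systems K A V
     \<and> (\<exists>h \<in> linear_maps K V A.
          (\<forall>x\<in>carrier V. \<forall>a\<in>carrier A. r' (x, a) = r (x, a) \<ominus>\<^bsub>A\<^esub> a \<otimes>\<^bsub>A\<^esub> h x)
        \<and> (\<forall>x\<in>carrier V. \<forall>y\<in>carrier V.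
             f' (x, y) = f (x, y) \<oplus>\<^bsub>A\<^esub> h (x \<otimes>\<^bsub>V\<^esub> y) \<oplus>\<^bsub>A\<^esub> h x \<otimes>\<^bsub>A\<^esub> h y
                         \<ominus>\<^bsub>A\<^esub> r (x, h y) \<ominus>\<^bsub>A\<^esub> r (y, h x)))}"

definition H2_nab ::
  "('k, 'r) ring_scheme \<Rightarrow> ('k, 'v) module \<Rightarrow> ('k, 'a) module
    \<Rightarrow> (('v \<times> 'a \<Rightarrow> 'a) \<times> ('v \<times> 'v \<Rightarrow> 'a)) set set" where
  "H2_nab K V A = crossed_systems K A V // cohomologous_systems K A V"

text \<open>
  The maps of an extension are not required to be extensional, and the operations of \<open>E\<close> are
  arbitrary outside its carrier; triples that agree on the carriers are cohomologous.
\<close>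

type_synonym ('k, 'a, 'v, 'e) ext_triple = "('k, 'e) module \<times> ('a \<Rightarrow> 'e) \<times> ('e \<Rightarrow> 'v)"

definition extensions ::
  "('k, 'r) ring_scheme \<Rightarrow> ('k, 'v) module \<Rightarrow> ('k, 'a) module \<Rightarrow> ('k, 'a, 'v, 'e) ext_triple set"
  where
  "extensions K V A = {(E, i, p). jordan_algebra K E
     \<and> i \<in> jordan_morphisms K A E \<and> p \<in> jordan_morphisms K E V
     \<and> a_kernel A E i = {\<zero>\<^bsub>A\<^esub>} \<and> i ` carrier A = a_kernel E V p \<and> p ` carrier E = carrier V}"

definition cohomologous_ext ::
  "('k, 'r) ring_scheme \<Rightarrow> ('k, 'v) module \<Rightarrow> ('k, 'a) module
    \<Rightarrow> ('k, 'a, 'v, 'e) ext_triple \<Rightarrow> ('k, 'a, 'v, 'e2) ext_triple \<Rightarrow> bool" where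
  "cohomologous_ext K V A = (\<lambda>(E, i, p) (E', i', p').
     \<exists>\<phi> \<in> jordan_morphisms K E E'.
       (\<forall>a\<in>carrier A. \<phi> (i a) = i' a) \<and> (\<forall>e\<in>carrier E. p' (\<phi> e) = p e))"

definition ext_rel ::
  "('k, 'r) ring_scheme \<Rightarrow> ('k, 'v) module \<Rightarrow> ('k, 'a) module
    \<Rightarrow> (('k, 'a, 'v, 'e) ext_triple \<times> ('k, 'a, 'v, 'e) ext_triple) set" where
  "ext_rel K V A = {(S, T). S \<in> extensions K V A \<and> T \<in> extensions K V A \<and> cohomologous_ext K V A S T}"

text \<open>
  A set cannot collect extensions of all types. \<open>Ext\<close> collects those whose carrier is a subset of
  the type \<open>'a \<times> 'v\<close>, which is where the crossed products live; every extension is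
  equinumerous with the product of the carriers of \<open>A\<close> and \<open>V\<close>.
\<close>

definition Ext ::
  "('k, 'r) ring_scheme \<Rightarrow> ('k, 'v) module \<Rightarrow> ('k, 'a) module
    \<Rightarrow> ('k, 'a, 'v, 'a \<times> 'v) ext_triple set set" where
  "Ext K V A = extensions K V A // ext_rel K V A"

definition crossed_ext ::
  "('k, 'a) module \<Rightarrow> ('k, 'v) module \<Rightarrow> ('v \<times> 'a \<Rightarrow> 'a) \<times> ('v \<times> 'v \<Rightarrow> 'a)
    \<Rightarrow> ('k, 'a, 'v, 'a \<times> 'v) ext_triple" where
  "crossed_ext A V = (\<lambda>(r, f). (crossed_product A V r f, \<lambda>a. (a, \<zero>\<^bsub>V\<^esub>), \<lambda>(a, x). x))"

end

theory Submission
  imports Defs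
begin

text \<open>
  Splitting \<open>(a, x) = (a, 0) + (0, x)\<close> in the Jordan identity of \<open>A \<times> V\<close>, its components are exactly
  the crossed system axioms, so crossed systems correspond to Jordan crossed products. The
  cohomology relation between crossed systems is the existence of a morphism between the
  associated extensions; as such morphisms are invertible, both relations are equivalences and
  the map on classes is well defined and injective. It is surjective because the projection of an
  extension has a linear section, by which the extension is identified with a crossed product.
\<close>

section \<open>Linear maps\<close>

text \<open>The Jordan identity is cubic in one variable and linear in the other, so its defect
  polarises: at \<open>(a, x)\<close> and \<open>(b, y)\<close> it is a sum of four pure terms,
  where each variable is taken from \<open>A\<close> or from \<open>V\<close>, and one mixed term.
  The pure terms are themselves values of the defect with some coordinates zero and therefore vanish
  separately. This is the origin of the axioms: one pure term is the Jordan identity of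
  \<open>A\<close>, three give (CP2) to (CP4), and the mixed term is the left-hand side of (CP5).
  The linear map in the definition of the cohomology relation measures a change of section: a
  morphism between crossed products carries the section \<open>x \<mapsto> (0, x)\<close> to
  \<open>x \<mapsto> (h x, x)\<close>. Since \<open>V\<close> may have infinite dimension, linear
  sections are obtained from Zorn's lemma. A further obstacle is that one set of extensions has one
  carrier type; morphisms are therefore compared across different carrier types, so that extensions
  on any type can be brought to the product type.\<close>

lemma (in abelian_group) minus_eq_zero_iff:
  assumes "x \<in> carrier G" "y \<in> carrier G"
  shows "x \<ominus> y = \<zero> \<longleftrightarrow> x = y"
  using assms minus_equality[of x "\<ominus> y"] by (auto simp: minus_eq r_neg)

lemma linear_mapsI:
  assumes "\<And>x. x \<in> carrier M \<Longrightarrow> h x \<in> carrier N"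
    and "\<And>x y. \<lbrakk>x \<in> carrier M; y \<in> carrier M\<rbrakk> \<Longrightarrow> h (x \<oplus>\<^bsub>M\<^esub> y) = h x \<oplus>\<^bsub>N\<^esub> h y"
    and "\<And>t x. \<lbrakk>t \<in> carrier K; x \<in> carrier M\<rbrakk> \<Longrightarrow> h (t \<odot>\<^bsub>M\<^esub> x) = t \<odot>\<^bsub>N\<^esub> h x"
  shows "h \<in> linear_maps K M N"
  using assms by (auto simp: linear_maps_def)

lemma linear_maps_closed: "\<lbrakk>h \<in> linear_maps K M N; x \<in> carrier M\<rbrakk> \<Longrightarrow> h x \<in> carrier N"
  and linear_maps_add: "\<lbrakk>h \<in> linear_maps K M N; x \<in> carrier M; y \<in> carrier M\<rbrakk>
    \<Longrightarrow> h (x \<oplus>\<^bsub>M\<^esub> y) = h x \<oplus>\<^bsub>N\<^esub> h y"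
  and linear_maps_smult: "\<lbrakk>h \<in> linear_maps K M N; t \<in> carrier K; x \<in> carrier M\<rbrakk>
    \<Longrightarrow> h (t \<odot>\<^bsub>M\<^esub> x) = t \<odot>\<^bsub>N\<^esub> h x"
  by (auto simp: linear_maps_def)

lemma linear_maps_zero:
  assumes "module K M" "module K N" "h \<in> linear_maps K M N"
  shows "h \<zero>\<^bsub>M\<^esub> = \<zero>\<^bsub>N\<^esub>"
proof -
  interpret M: module K M by fact
  interpret N: module K N by fact
  have "h \<zero>\<^bsub>M\<^esub> = h (\<zero>\<^bsub>K\<^esub> \<odot>\<^bsub>M\<^esub> \<zero>\<^bsub>M\<^esub>)" by simp
  also have "\<dots> = \<zero>\<^bsub>N\<^esub>"
    using assms(3) linear_maps_closed[OF assms(3)] by (subst linear_maps_smult) auto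
  finally show ?thesis .
qed

lemma linear_maps_a_inv:
  assumes "module K M" "module K N" "h \<in> linear_maps K M N" "x \<in> carrier M"
  shows "h (\<ominus>\<^bsub>M\<^esub> x) = \<ominus>\<^bsub>N\<^esub> h x"
proof -
  interpret M: module K M by fact
  interpret N: module K N by fact
  have "h (\<ominus>\<^bsub>M\<^esub> x) \<oplus>\<^bsub>N\<^esub> h x = h (\<ominus>\<^bsub>M\<^esub> x \<oplus>\<^bsub>M\<^esub> x)"
    using assms by (simp add: linear_maps_add)
  also have "\<dots> = \<zero>\<^bsub>N\<^esub>"
    using assms linear_maps_zero[OF assms(1-3)] by (simp add: M.M.l_neg)
  finally show ?thesis
    using assms by (simp add: N.M.minus_equality linear_maps_closed[OF assms(3)])
qed

lemma linear_maps_minus: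
  assumes "module K M" "module K N" "h \<in> linear_maps K M N" "x \<in> carrier M" "y \<in> carrier M"
  shows "h (x \<ominus>\<^bsub>M\<^esub> y) = h x \<ominus>\<^bsub>N\<^esub> h y"
proof -
  interpret M: module K M by fact
  show ?thesis
    using assms by (simp add: a_minus_def linear_maps_add linear_maps_a_inv)
qed

text \<open>Stated for a submodule because the section below comes from inverting a map on a
  complement of its kernel; the five lemma takes the whole carrier.\<close>

lemma linear_maps_inj_on:
  assumes "module K M" "module K N" "h \<in> linear_maps K M N" "submodule W K M"
    and ker: "\<And>x. \<lbrakk>x \<in> W; h x = \<zero>\<^bsub>N\<^esub>\<rbrakk> \<Longrightarrow> x = \<zero>\<^bsub>M\<^esub>"
  shows "inj_on h W"
proof (rule inj_onI)
  interpret M: module K M by fact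
  interpret N: module K N by fact
  note sub = M.submoduleE[OF assms(4)]
  fix x y assume xy: "x \<in> W" "y \<in> W" "h x = h y"
  then have c: "x \<in> carrier M" "y \<in> carrier M" using sub(1) by auto
  have "h (x \<ominus>\<^bsub>M\<^esub> y) = \<zero>\<^bsub>N\<^esub>"
    using linear_maps_minus[OF assms(1-3) c] xy c linear_maps_closed[OF assms(3)]
    by (simp add: a_minus_def N.M.r_neg)
  moreover have "x \<ominus>\<^bsub>M\<^esub> y \<in> W" using sub xy by (simp add: a_minus_def)
  ultimately show "x = y"
    using ker c by (metis M.M.minus_eq_zero_iff)
qed

lemma linear_maps_inj_on_carrier:
  assumes "module K M" "module K N" "h \<in> linear_maps K M N" "a_kernel M N h = {\<zero>\<^bsub>M\<^esub>}"
  shows "inj_on h (carrier M)"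
  using assms(4) module.carrier_is_submodule[OF assms(1)]
  by (intro linear_maps_inj_on[OF assms(1-3)]) (auto simp: a_kernel_def')

text \<open>
  A submodule that is maximal among those meeting the kernel trivially is mapped isomorphically
  onto the target, and the inverse of that restriction is a section.
\<close>

lemma linear_section_exists:
  assumes "field K" "module K M" "module K N" "p \<in> linear_maps K M N"
    and surj: "p ` carrier M = carrier N"
  obtains s where "s \<in> linear_maps K N M" "\<And>y. y \<in> carrier N \<Longrightarrow> p (s y) = y"
proof -
  interpret K: field K by fact
  interpret M: module K M by fact
  interpret N: module K N by fact
  note p = assms(4)
  define \<W> where "\<W> = {W. submodule W K M \<and> (\<forall>w\<in>W. p w = \<zero>\<^bsub>N\<^esub> \<longrightarrow> w = \<zero>\<^bsub>M\<^esub>)}"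
  have "submodule {\<zero>\<^bsub>M\<^esub>} K M" by (rule M.submoduleI) auto
  then have "\<W> \<noteq> {}" by (auto simp: \<W>_def)
  \<comment> \<open>Zorn's lemma asks that the union of a nonempty chain stay in the family. Closure
    under sums holds because two of its elements lie in a common member.\<close>
  moreover have "\<Union>\<C> \<in> \<W>" if ne: "\<C> \<noteq> {}" and ch: "subset.chain \<W> \<C>" for \<C>
  proof -
    have sm: "submodule W K M" if "W \<in> \<C>" for W
      using ch that by (auto simp: \<W>_def subset.chain_def)
    have tot: "W \<subseteq> W' \<or> W' \<subseteq> W" if "W \<in> \<C>" "W' \<in> \<C>" for W W'
      using ch that by (auto simp: subset_chain_def)
    have "submodule (\<Union>\<C>) K M"
    proof (rule M.submoduleI)
      show "\<Union>\<C> \<subseteq> carrier M" using M.submoduleE(1)[OF sm] by blast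
      obtain W w where "W \<in> \<C>" "w \<in> W" using ne M.submoduleE(2)[OF sm] by blast
      then show "\<zero>\<^bsub>M\<^esub> \<in> \<Union>\<C>"
        using M.submoduleE(4)[OF sm, of W "\<zero>\<^bsub>K\<^esub>" w] M.submoduleE(1)[OF sm, of W]
        by (auto simp: subsetD)
      show "\<ominus>\<^bsub>M\<^esub> a \<in> \<Union>\<C>" if "a \<in> \<Union>\<C>" for a
        using that M.submoduleE(3)[OF sm] by blast
      show "t \<odot>\<^bsub>M\<^esub> a \<in> \<Union>\<C>" if "t \<in> carrier K" "a \<in> \<Union>\<C>" for t a
        using that M.submoduleE(4)[OF sm] by blast
      show "a \<oplus>\<^bsub>M\<^esub> b \<in> \<Union>\<C>" if ab: "a \<in> \<Union>\<C>" "b \<in> \<Union>\<C>" for a b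
      proof -
        obtain W W' where "W \<in> \<C>" "a \<in> W" "W' \<in> \<C>" "b \<in> W'" using ab by auto
        then obtain U where "U \<in> \<C>" "a \<in> U" "b \<in> U" using tot[of W W'] by blast
        then show ?thesis using M.submoduleE(5)[OF sm] by blast
      qed
    qed
    then show ?thesis using ch by (auto simp: \<W>_def subset.chain_def)
  qed
  ultimately obtain W where W: "W \<in> \<W>" and max: "\<And>X. \<lbrakk>X \<in> \<W>; W \<subseteq> X\<rbrakk> \<Longrightarrow> X = W"
    using subset_Zorn_nonempty[of \<W>] by blast
  have smW: "submodule W K M" and kerW: "\<And>w. \<lbrakk>w \<in> W; p w = \<zero>\<^bsub>N\<^esub>\<rbrakk> \<Longrightarrow> w = \<zero>\<^bsub>M\<^esub>"
    using W by (auto simp: \<W>_def)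
  note subW = M.submoduleE[OF smW]
  have WM: "w \<in> carrier M" if "w \<in> W" for w using subW(1) that by blast
  obtain w where "w \<in> W" using subW(2) by blast
  then have zW: "\<zero>\<^bsub>M\<^esub> \<in> W" using subW(4)[OF K.zero_closed, of w] WM[of w] by simp
  have onto: "v \<in> p ` W" if v: "v \<in> carrier N" for v
  proof (rule ccontr)
    assume nv: "v \<notin> p ` W"
    obtain e where e: "e \<in> carrier M" "p e = v" using v by (auto simp flip: surj)
    \<comment> \<open>A vector \<open>v\<close> missed by \<open>p\<close> on \<open>W\<close> is
      lifted to \<open>e\<close>, and the line through \<open>e\<close> is adjoined to
      \<open>W\<close>. The larger space still meets the kernel trivially, against
      maximality.\<close>
    define X where "X = {w \<oplus>\<^bsub>M\<^esub> t \<odot>\<^bsub>M\<^esub> e | w t. w \<in> W \<and> t \<in> carrier K}"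
    have XI: "w \<oplus>\<^bsub>M\<^esub> t \<odot>\<^bsub>M\<^esub> e \<in> X" if "w \<in> W" "t \<in> carrier K" for w t
      using that by (auto simp: X_def)
    have "submodule X K M"
    proof (rule M.submoduleI)
      show "X \<subseteq> carrier M" using WM e by (auto simp: X_def)
      show "\<zero>\<^bsub>M\<^esub> \<in> X" using XI[OF zW K.zero_closed] e by simp
      fix a assume "a \<in> X"
      then obtain w t where a: "a = w \<oplus>\<^bsub>M\<^esub> t \<odot>\<^bsub>M\<^esub> e" "w \<in> W" "t \<in> carrier K"
        by (auto simp: X_def)
      have "\<ominus>\<^bsub>M\<^esub> a = \<ominus>\<^bsub>M\<^esub> w \<oplus>\<^bsub>M\<^esub> (\<ominus>\<^bsub>K\<^esub> t) \<odot>\<^bsub>M\<^esub> e"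
        using a WM e by (simp add: M.M.minus_add M.smult_l_minus)
      then show "\<ominus>\<^bsub>M\<^esub> a \<in> X" using XI a subW(3) by simp
      show "u \<odot>\<^bsub>M\<^esub> a \<in> X" if u: "u \<in> carrier K" for u
      proof -
        have "u \<odot>\<^bsub>M\<^esub> a = u \<odot>\<^bsub>M\<^esub> w \<oplus>\<^bsub>M\<^esub> (u \<otimes>\<^bsub>K\<^esub> t) \<odot>\<^bsub>M\<^esub> e"
          using a WM e u by (simp add: M.smult_r_distr M.smult_assoc1)
        then show ?thesis using XI a subW(4) u by simp
      qed
      fix b assume "b \<in> X"
      then obtain w' t' where b: "b = w' \<oplus>\<^bsub>M\<^esub> t' \<odot>\<^bsub>M\<^esub> e" "w' \<in> W" "t' \<in> carrier K"
        by (auto simp: X_def)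
      have "a \<oplus>\<^bsub>M\<^esub> b = (w \<oplus>\<^bsub>M\<^esub> w') \<oplus>\<^bsub>M\<^esub> (t \<oplus>\<^bsub>K\<^esub> t') \<odot>\<^bsub>M\<^esub> e"
        using a b WM e by (simp add: M.smult_l_distr M.M.a_ac)
      then show "a \<oplus>\<^bsub>M\<^esub> b \<in> X" using XI a b subW(5) by simp
    qed
    moreover have "x = \<zero>\<^bsub>M\<^esub>" if xX: "x \<in> X" "p x = \<zero>\<^bsub>N\<^esub>" for x
    proof -
      obtain w t where x: "x = w \<oplus>\<^bsub>M\<^esub> t \<odot>\<^bsub>M\<^esub> e" "w \<in> W" "t \<in> carrier K"
        using xX by (auto simp: X_def)
      have pw: "p w \<in> carrier N" using linear_maps_closed[OF p] WM x by blast
      have eq: "p w \<oplus>\<^bsub>N\<^esub> t \<odot>\<^bsub>N\<^esub> v = \<zero>\<^bsub>N\<^esub>"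
        using xX x WM e by (simp add: linear_maps_add[OF p] linear_maps_smult[OF p])
      \<comment> \<open>A nonzero \<open>t\<close> could be inverted, which would exhibit
        \<open>v\<close> as the image of a scalar multiple of \<open>w\<close>, an element of
        \<open>W\<close>. With \<open>t\<close> zero the vector \<open>x\<close> is \<open>w\<close>
        itself, and \<open>kerW\<close> applies.\<close>
      have "t = \<zero>\<^bsub>K\<^esub>"
      proof (rule ccontr)
        assume "t \<noteq> \<zero>\<^bsub>K\<^esub>"
        then have t: "t \<in> Units K" using x K.field_Units by simp
        define u where "u = inv\<^bsub>K\<^esub> t"
        have u: "u \<in> carrier K" "u \<otimes>\<^bsub>K\<^esub> t = \<one>\<^bsub>K\<^esub>" using t by (auto simp: u_def)
        have "t \<odot>\<^bsub>N\<^esub> v = \<ominus>\<^bsub>N\<^esub> p w"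
          using eq pw v x by (metis N.M.a_comm N.M.minus_equality N.smult_closed)
        then have "u \<odot>\<^bsub>N\<^esub> (t \<odot>\<^bsub>N\<^esub> v) = p (u \<odot>\<^bsub>M\<^esub> (\<ominus>\<^bsub>M\<^esub> w))"
          using u x WM by (simp add: linear_maps_smult[OF p] linear_maps_a_inv[OF assms(2,3) p])
        then have "v = p (u \<odot>\<^bsub>M\<^esub> (\<ominus>\<^bsub>M\<^esub> w))"
          using u v x by (simp flip: N.smult_assoc1)
        then show False using nv subW x u by blast
      qed
      then show ?thesis using eq x pw v e kerW WM by simp
    qed
    ultimately have "X \<in> \<W>" by (simp add: \<W>_def)
    moreover have "W \<subseteq> X"
      using XI[OF _ K.zero_closed] WM e by auto
    ultimately have "X = W" by (rule max)
    \<comment> \<open>\<open>e\<close> is the element of \<open>X\<close> with \<open>W\<close>-part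
      zero and coefficient one.\<close>
    then have "e \<in> W" using XI[OF zW K.one_closed] e by simp
    then show False using nv e by blast
  qed
  have inj: "inj_on p W" by (rule linear_maps_inj_on[OF assms(2,3) p smW kerW])
  define s where "s = inv_into W p"
  have sW: "s y \<in> W" and ps: "p (s y) = y" if "y \<in> carrier N" for y
    using onto[OF that] by (simp_all add: s_def inv_into_into f_inv_into_f)
  have s_eq: "s y = w" if "w \<in> W" "p w = y" for w y
    using that inj by (auto simp: s_def)
  \<comment> \<open>Sums and multiples of values of \<open>s\<close> stay in \<open>W\<close>, where
    preimages under \<open>p\<close> are unique, so linearity passes from \<open>p\<close> to its
    inverse.\<close>
  have "s \<in> linear_maps K N M"
  proof (rule linear_mapsI)
    show "s y \<in> carrier M" if "y \<in> carrier N" for y using WM sW that by blast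
    show "s (x \<oplus>\<^bsub>N\<^esub> y) = s x \<oplus>\<^bsub>M\<^esub> s y" if "x \<in> carrier N" "y \<in> carrier N" for x y
      using that sW WM ps by (intro s_eq subW(5)) (simp_all add: linear_maps_add[OF p])
    show "s (t \<odot>\<^bsub>N\<^esub> x) = t \<odot>\<^bsub>M\<^esub> s x" if "t \<in> carrier K" "x \<in> carrier N" for t x
      using that sW WM ps by (intro s_eq subW(4)) (simp_all add: linear_maps_smult[OF p])
  qed
  then show thesis using ps that by blast
qed

section \<open>Commutative nonassociative algebras\<close>

text \<open>A Jordan algebra without the Jordan identity. The crossed product has to be calculated
  in before that identity is known to hold.\<close>

locale comm_algebra = module K J + field K
  for K :: "('k, 'r) ring_scheme" (structure) and J :: "('k, 'm) module" (structure) +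
  assumes prod_closed [simp, intro]: "\<lbrakk>a \<in> carrier J; b \<in> carrier J\<rbrakk> \<Longrightarrow> a \<otimes>\<^bsub>J\<^esub> b \<in> carrier J"
    and prod_commute: "\<lbrakk>a \<in> carrier J; b \<in> carrier J\<rbrakk> \<Longrightarrow> a \<otimes>\<^bsub>J\<^esub> b = b \<otimes>\<^bsub>J\<^esub> a"
    and prod_add_left: "\<lbrakk>a \<in> carrier J; b \<in> carrier J; c \<in> carrier J\<rbrakk>
          \<Longrightarrow> (a \<oplus>\<^bsub>J\<^esub> b) \<otimes>\<^bsub>J\<^esub> c = a \<otimes>\<^bsub>J\<^esub> c \<oplus>\<^bsub>J\<^esub> b \<otimes>\<^bsub>J\<^esub> c"
    and prod_smult_left: "\<lbrakk>t \<in> carrier K; a \<in> carrier J; b \<in> carrier J\<rbrakk>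
          \<Longrightarrow> (t \<odot>\<^bsub>J\<^esub> a) \<otimes>\<^bsub>J\<^esub> b = t \<odot>\<^bsub>J\<^esub> (a \<otimes>\<^bsub>J\<^esub> b)"
begin

lemma is_module: "module K J" ..

lemma is_field: "field K" ..

lemma prod_add_right: "\<lbrakk>a \<in> carrier J; b \<in> carrier J; c \<in> carrier J\<rbrakk>
    \<Longrightarrow> c \<otimes>\<^bsub>J\<^esub> (a \<oplus>\<^bsub>J\<^esub> b) = c \<otimes>\<^bsub>J\<^esub> a \<oplus>\<^bsub>J\<^esub> c \<otimes>\<^bsub>J\<^esub> b"
  by (simp add: prod_commute[of c] prod_add_left)

lemma prod_smult_right: "\<lbrakk>t \<in> carrier K; a \<in> carrier J; b \<in> carrier J\<rbrakk>
    \<Longrightarrow> b \<otimes>\<^bsub>J\<^esub> (t \<odot>\<^bsub>J\<^esub> a) = t \<odot>\<^bsub>J\<^esub> (b \<otimes>\<^bsub>J\<^esub> a)"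
  by (simp add: prod_commute[of b] prod_smult_left)

lemma prod_zero_left [simp]: "a \<in> carrier J \<Longrightarrow> \<zero>\<^bsub>J\<^esub> \<otimes>\<^bsub>J\<^esub> a = \<zero>\<^bsub>J\<^esub>"
  using prod_smult_left[of "\<zero>\<^bsub>K\<^esub>" "\<zero>\<^bsub>J\<^esub>" a] by simp

lemma prod_zero_right [simp]: "a \<in> carrier J \<Longrightarrow> a \<otimes>\<^bsub>J\<^esub> \<zero>\<^bsub>J\<^esub> = \<zero>\<^bsub>J\<^esub>"
  by (simp add: prod_commute[of a])

section \<open>Associators and the polarised Jordan identity\<close>

lemma associator_closed [simp, intro]:
  "\<lbrakk>u \<in> carrier J; v \<in> carrier J; w \<in> carrier J\<rbrakk> \<Longrightarrow> associator J u v w \<in> carrier J"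
  by (simp add: associator_def)

lemma associator_add:
  assumes "u \<in> carrier J" "u' \<in> carrier J" "v \<in> carrier J" "w \<in> carrier J"
  shows "associator J (u \<oplus>\<^bsub>J\<^esub> u') v w = associator J u v w \<oplus>\<^bsub>J\<^esub> associator J u' v w"
    and "associator J v (u \<oplus>\<^bsub>J\<^esub> u') w = associator J v u w \<oplus>\<^bsub>J\<^esub> associator J v u' w"
    and "associator J v w (u \<oplus>\<^bsub>J\<^esub> u') = associator J v w u \<oplus>\<^bsub>J\<^esub> associator J v w u'"
  using assms
  by (simp_all add: associator_def a_minus_def prod_add_left prod_add_right M.minus_add M.a_ac)

text \<open>Writing the multiple by 2 as a repeated summand lets the additive laws of the group
  normalise expressions in \<open>jordan_P\<close>.\<close>

lemma jordan_P_eq: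
  assumes "u \<in> carrier J" "v \<in> carrier J" "w \<in> carrier J"
  shows "jordan_P J u v w = associator J (u \<otimes>\<^bsub>J\<^esub> u) v w
    \<oplus>\<^bsub>J\<^esub> (associator J (u \<otimes>\<^bsub>J\<^esub> w) v u \<oplus>\<^bsub>J\<^esub> associator J (u \<otimes>\<^bsub>J\<^esub> w) v u)"
  using assms by (simp add: jordan_P_def numeral_2_eq_2)

lemma jordan_P_closed [simp, intro]:
  "\<lbrakk>u \<in> carrier J; v \<in> carrier J; w \<in> carrier J\<rbrakk> \<Longrightarrow> jordan_P J u v w \<in> carrier J"
  by (simp add: jordan_P_eq)

lemma jordan_P_add:
  assumes "u \<in> carrier J" "v \<in> carrier J" "v' \<in> carrier J" "w \<in> carrier J"
  shows "jordan_P J u (v \<oplus>\<^bsub>J\<^esub> v') w = jordan_P J u v w \<oplus>\<^bsub>J\<^esub> jordan_P J u v' w"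
  using assms by (simp add: jordan_P_eq associator_add M.a_ac)

text \<open>This is where \<open>P\<close> comes from. By commutativity the square of
  \<open>u + w\<close> is the sum of both squares and twice the product \<open>u w\<close>; sorting
  the resulting associators by degree, those of degree two in \<open>u\<close> and one in
  \<open>w\<close> form \<open>P(u, v, w)\<close>, and those with the degrees exchanged form
  \<open>P(w, v, u)\<close>.\<close>

lemma associator_square_add:
  assumes "u \<in> carrier J" "v \<in> carrier J" "w \<in> carrier J"
  shows "associator J ((u \<oplus>\<^bsub>J\<^esub> w) \<otimes>\<^bsub>J\<^esub> (u \<oplus>\<^bsub>J\<^esub> w)) v (u \<oplus>\<^bsub>J\<^esub> w)
    = associator J (u \<otimes>\<^bsub>J\<^esub> u) v u \<oplus>\<^bsub>J\<^esub> associator J (w \<otimes>\<^bsub>J\<^esub> w) v w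
      \<oplus>\<^bsub>J\<^esub> (jordan_P J u v w \<oplus>\<^bsub>J\<^esub> jordan_P J w v u)"
  using assms
  by (simp add: jordan_P_eq associator_add prod_add_left prod_add_right prod_commute[of w u] M.a_ac)

lemma associator_square_eq_zero_iff:
  assumes "a \<in> carrier J" "b \<in> carrier J"
  shows "associator J (a \<otimes>\<^bsub>J\<^esub> a) b a = \<zero>\<^bsub>J\<^esub>
    \<longleftrightarrow> ((a \<otimes>\<^bsub>J\<^esub> a) \<otimes>\<^bsub>J\<^esub> b) \<otimes>\<^bsub>J\<^esub> a = (a \<otimes>\<^bsub>J\<^esub> a) \<otimes>\<^bsub>J\<^esub> (b \<otimes>\<^bsub>J\<^esub> a)"
  using assms by (simp add: associator_def M.minus_eq_zero_iff)

text \<open>As the vanishing of an associator the identity becomes a statement about an expression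
  that is additive in each slot, which is the form that can be polarised.\<close>

lemma jordan_algebra_iff:
  "jordan_algebra K J
    \<longleftrightarrow> (\<forall>a\<in>carrier J. \<forall>b\<in>carrier J. associator J (a \<otimes>\<^bsub>J\<^esub> a) b a = \<zero>\<^bsub>J\<^esub>)" (is "_ \<longleftrightarrow> ?R")
proof
  assume "jordan_algebra K J"
  then show ?R by (simp add: associator_square_eq_zero_iff jordan_algebra.jordan_identity)
next
  assume ?R
  then have "((a \<otimes>\<^bsub>J\<^esub> a) \<otimes>\<^bsub>J\<^esub> b) \<otimes>\<^bsub>J\<^esub> a = (a \<otimes>\<^bsub>J\<^esub> a) \<otimes>\<^bsub>J\<^esub> (b \<otimes>\<^bsub>J\<^esub> a)"
    if "a \<in> carrier J" "b \<in> carrier J" for a b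
    using that by (simp add: associator_square_eq_zero_iff)
  then show "jordan_algebra K J"
    by unfold_locales (auto simp: prod_add_left prod_smult_left intro: prod_commute)
qed

end

lemma jordan_algebra_imp_comm_algebra:
  assumes "jordan_algebra K J"
  shows "comm_algebra K J"
proof -
  interpret jordan_algebra K J by fact
  show ?thesis
    by unfold_locales
      (auto simp: mult_closed mult_add_left mult_smult_left intro: mult_commute)
qed

section \<open>Crossed products\<close>

lemma bilinear_mapsI:
  assumes "h \<in> extensional (carrier M \<times> carrier N)"
    and "\<And>x. x \<in> carrier M \<Longrightarrow> (\<lambda>y. h (x, y)) \<in> linear_maps K N P"
    and "\<And>y. y \<in> carrier N \<Longrightarrow> (\<lambda>x. h (x, y)) \<in> linear_maps K M P"
  shows "h \<in> bilinear_maps K M N P"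
  using assms linear_maps_closed[OF assms(2)] by (auto simp: bilinear_maps_def PiE_def)

lemma bilinear_maps_closed:
  "\<lbrakk>h \<in> bilinear_maps K M N P; x \<in> carrier M; y \<in> carrier N\<rbrakk> \<Longrightarrow> h (x, y) \<in> carrier P"
  by (auto simp: bilinear_maps_def)

lemma bilinear_maps_linear:
  assumes "h \<in> bilinear_maps K M N P"
  shows "x \<in> carrier M \<Longrightarrow> (\<lambda>y. h (x, y)) \<in> linear_maps K N P"
    and "y \<in> carrier N \<Longrightarrow> (\<lambda>x. h (x, y)) \<in> linear_maps K M P"
  using assms by (auto simp: bilinear_maps_def)

text \<open>(CP1) is included because it makes the crossed product commutative. (CP2) to (CP5) are
  left out: they are to be characterised by the Jordan identity.\<close>

locale crossed_datum = A: comm_algebra K A + V: comm_algebra K V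
  for K :: "('k, 'r) ring_scheme" (structure)
    and A :: "('k, 'a) module" (structure) and V :: "('k, 'v) module" (structure) +
  fixes r :: "'v \<times> 'a \<Rightarrow> 'a" and f :: "'v \<times> 'v \<Rightarrow> 'a"
  assumes r_bilinear: "r \<in> bilinear_maps K V A A"
    and f_bilinear: "f \<in> bilinear_maps K V V A"
    and f_sym: "CP1 V f"
begin

section \<open>Arithmetic of the crossed product\<close>

abbreviation E :: "('k, 'a \<times> 'v) module" where "E \<equiv> crossed_product A V r f"

lemma r_closed [simp, intro]: "\<lbrakk>x \<in> carrier V; a \<in> carrier A\<rbrakk> \<Longrightarrow> r (x, a) \<in> carrier A"
  by (rule bilinear_maps_closed[OF r_bilinear])

lemma f_closed [simp, intro]: "\<lbrakk>x \<in> carrier V; y \<in> carrier V\<rbrakk> \<Longrightarrow> f (x, y) \<in> carrier A"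
  by (rule bilinear_maps_closed[OF f_bilinear])

lemma f_commute: "\<lbrakk>x \<in> carrier V; y \<in> carrier V\<rbrakk> \<Longrightarrow> f (x, y) = f (y, x)"
  using f_sym by (auto simp: CP1_def)

lemmas r_add = linear_maps_add[OF bilinear_maps_linear(1)[OF r_bilinear]]
  linear_maps_add[OF bilinear_maps_linear(2)[OF r_bilinear]]
lemmas r_smult = linear_maps_smult[OF bilinear_maps_linear(1)[OF r_bilinear]]
  linear_maps_smult[OF bilinear_maps_linear(2)[OF r_bilinear]]
lemmas r_zero [simp] =
  linear_maps_zero[OF A.is_module A.is_module bilinear_maps_linear(1)[OF r_bilinear]]
  linear_maps_zero[OF V.is_module A.is_module bilinear_maps_linear(2)[OF r_bilinear]]
lemmas f_add = linear_maps_add[OF bilinear_maps_linear(1)[OF f_bilinear]]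
  linear_maps_add[OF bilinear_maps_linear(2)[OF f_bilinear]]
lemmas f_smult = linear_maps_smult[OF bilinear_maps_linear(1)[OF f_bilinear]]
  linear_maps_smult[OF bilinear_maps_linear(2)[OF f_bilinear]]
lemmas f_zero [simp] =
  linear_maps_zero[OF V.is_module A.is_module bilinear_maps_linear(1)[OF f_bilinear]]
  linear_maps_zero[OF V.is_module A.is_module bilinear_maps_linear(2)[OF f_bilinear]]

lemma E_carrier: "carrier E = carrier A \<times> carrier V"
  and E_zero: "\<zero>\<^bsub>E\<^esub> = (\<zero>\<^bsub>A\<^esub>, \<zero>\<^bsub>V\<^esub>)"
  by (simp_all add: crossed_product_def)

lemma E_simps [simp]:
  "(a, x) \<in> carrier E \<longleftrightarrow> a \<in> carrier A \<and> x \<in> carrier V"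
  "(a, x) \<oplus>\<^bsub>E\<^esub> (b, y) = (a \<oplus>\<^bsub>A\<^esub> b, x \<oplus>\<^bsub>V\<^esub> y)"
  "t \<odot>\<^bsub>E\<^esub> (a, x) = (t \<odot>\<^bsub>A\<^esub> a, t \<odot>\<^bsub>V\<^esub> x)"
  "(a, x) \<otimes>\<^bsub>E\<^esub> (b, y) =
    (a \<otimes>\<^bsub>A\<^esub> b \<oplus>\<^bsub>A\<^esub> r (x, b) \<oplus>\<^bsub>A\<^esub> r (y, a) \<oplus>\<^bsub>A\<^esub> f (x, y), x \<otimes>\<^bsub>V\<^esub> y)"
  by (simp_all add: crossed_product_def)

lemma module_E: "module K E"
proof (rule moduleI)
  show "cring K" by (rule A.is_cring)
  show "abelian_group E"
  proof (rule abelian_groupI)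
    fix u assume "u \<in> carrier E"
    then show "\<exists>v\<in>carrier E. v \<oplus>\<^bsub>E\<^esub> u = \<zero>\<^bsub>E\<^esub>"
      by (intro bexI[of _ "(\<ominus>\<^bsub>A\<^esub> fst u, \<ominus>\<^bsub>V\<^esub> snd u)"]) (auto simp: E_carrier E_zero A.M.l_neg V.M.l_neg)
  qed (auto simp: E_carrier E_zero A.M.a_ac V.M.a_ac)
qed (auto simp: E_carrier A.smult_l_distr A.smult_r_distr A.smult_assoc1
      V.smult_l_distr V.smult_r_distr V.smult_assoc1)

lemma comm_algebra_E: "comm_algebra K E"
proof -
  interpret module K E by (rule module_E)
  show ?thesis
  proof
    fix u v w t
    assume uvw: "u \<in> carrier E" "v \<in> carrier E"
    obtain a x b y where uv: "u = (a, x)" "v = (b, y)" by (cases u; cases v)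
    with uvw have [simp]: "a \<in> carrier A" "b \<in> carrier A" "x \<in> carrier V" "y \<in> carrier V"
      by auto
    show "u \<otimes>\<^bsub>E\<^esub> v \<in> carrier E" by (simp add: uv)
    show "u \<otimes>\<^bsub>E\<^esub> v = v \<otimes>\<^bsub>E\<^esub> u"
      using A.prod_commute[of a b] V.prod_commute[of x y] f_commute[of x y]
      by (simp add: uv A.M.a_ac)
    show "(t \<odot>\<^bsub>E\<^esub> u) \<otimes>\<^bsub>E\<^esub> v = t \<odot>\<^bsub>E\<^esub> (u \<otimes>\<^bsub>E\<^esub> v)" if "t \<in> carrier K"
      using that by (simp add: uv A.prod_smult_left V.prod_smult_left r_smult f_smult A.smult_r_distr)
    show "(u \<oplus>\<^bsub>E\<^esub> v) \<otimes>\<^bsub>E\<^esub> w = u \<otimes>\<^bsub>E\<^esub> w \<oplus>\<^bsub>E\<^esub> v \<otimes>\<^bsub>E\<^esub> w" if "w \<in> carrier E"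
      using that by (cases w) (simp add: uv A.prod_add_left V.prod_add_left r_add f_add A.M.a_ac)
  qed
qed

text \<open>The pure term on \<open>A\<close> vanishes since \<open>A\<close> is Jordan. Those with
  first argument from \<open>A\<close> and second from \<open>V\<close>, and the reverse, are (CP2)
  and (CP3). With both from \<open>V\<close>, the \<open>V\<close>-coordinate vanishes since
  \<open>V\<close> is Jordan and the \<open>A\<close>-coordinate is (CP4). What remains is the
  expression of (CP5).\<close>

lemma jordan_crossed_product_iff:
  assumes "jordan_algebra K A" "jordan_algebra K V"
  shows "jordan_algebra K E \<longleftrightarrow> CP2 A V r \<and> CP3 A V r f \<and> CP4 A V r f \<and> CP5 A V r f"
proof -
  interpret E: comm_algebra K E by (rule comm_algebra_E)
  let ?A = "\<lambda>a. (a, \<zero>\<^bsub>V\<^esub>)" and ?V = "\<lambda>x. (\<zero>\<^bsub>A\<^esub>, x)"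
  \<comment> \<open>\<open>D X Y\<close> is the defect of the Jordan identity at \<open>X\<close>,
    \<open>Y\<close>; \<open>S\<close> is its part mixing \<open>A\<close> and \<open>V\<close> in
    the cubic variable.\<close>
  define D where "D X Y = associator E (X \<otimes>\<^bsub>E\<^esub> X) Y X" for X Y
  define S where "S a b x y = jordan_P E (?A a) (?A b) (?V x) \<oplus>\<^bsub>E\<^esub> jordan_P E (?V x) (?A b) (?A a)
        \<oplus>\<^bsub>E\<^esub> jordan_P E (?A a) (?V y) (?V x) \<oplus>\<^bsub>E\<^esub> jordan_P E (?V x) (?V y) (?A a)" for a b x y
  have jordan: "jordan_algebra K E \<longleftrightarrow> (\<forall>X\<in>carrier E. \<forall>Y\<in>carrier E. D X Y = \<zero>\<^bsub>E\<^esub>)"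
    unfolding D_def by (rule E.jordan_algebra_iff)
  have D_closed: "D X Y \<in> carrier E" if "X \<in> carrier E" "Y \<in> carrier E" for X Y
    using that unfolding D_def by blast
  have S_closed: "S a b x y \<in> carrier E"
    if "a \<in> carrier A" "b \<in> carrier A" "x \<in> carrier V" "y \<in> carrier V" for a b x y
    using that unfolding S_def by simp
  have split: "D (a, x) (b, y)
      = D (?A a) (?A b) \<oplus>\<^bsub>E\<^esub> D (?A a) (?V y) \<oplus>\<^bsub>E\<^esub> (D (?V x) (?A b) \<oplus>\<^bsub>E\<^esub> D (?V x) (?V y)) \<oplus>\<^bsub>E\<^esub> S a b x y"
    if "a \<in> carrier A" "b \<in> carrier A" "x \<in> carrier V" "y \<in> carrier V" for a b x y
  proof -
    have mem: "?A a \<in> carrier E" "?A b \<in> carrier E" "?V x \<in> carrier E" "?V y \<in> carrier E"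
      using that by simp_all
    have "(a, x) = ?A a \<oplus>\<^bsub>E\<^esub> ?V x" "(b, y) = ?A b \<oplus>\<^bsub>E\<^esub> ?V y" using that by simp_all
    then have "D (a, x) (b, y) = D (?A a \<oplus>\<^bsub>E\<^esub> ?V x) (?A b \<oplus>\<^bsub>E\<^esub> ?V y)" by (simp only:)
    also have "\<dots> = D (?A a) (?A b \<oplus>\<^bsub>E\<^esub> ?V y) \<oplus>\<^bsub>E\<^esub> D (?V x) (?A b \<oplus>\<^bsub>E\<^esub> ?V y)
      \<oplus>\<^bsub>E\<^esub> (jordan_P E (?A a) (?A b \<oplus>\<^bsub>E\<^esub> ?V y) (?V x) \<oplus>\<^bsub>E\<^esub> jordan_P E (?V x) (?A b \<oplus>\<^bsub>E\<^esub> ?V y) (?A a))"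
      unfolding D_def using mem by (intro E.associator_square_add) blast+
    also have "\<dots> = D (?A a) (?A b) \<oplus>\<^bsub>E\<^esub> D (?A a) (?V y) \<oplus>\<^bsub>E\<^esub> (D (?V x) (?A b) \<oplus>\<^bsub>E\<^esub> D (?V x) (?V y))
        \<oplus>\<^bsub>E\<^esub> S a b x y"
    proof -
      have D_add: "D X (Y \<oplus>\<^bsub>E\<^esub> Z) = D X Y \<oplus>\<^bsub>E\<^esub> D X Z"
        if "X \<in> carrier E" "Y \<in> carrier E" "Z \<in> carrier E" for X Y Z
        using that unfolding D_def by (intro E.associator_add) blast+
      note closed = mem D_closed E.jordan_P_closed E.M.a_closed
      \<comment> \<open>Restricted rewriting keeps \<open>E_simps\<close> from evaluating the pairs
        in coordinates; only additivity in the second argument and reordering of summands are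
        wanted.\<close>
      show ?thesis
        unfolding S_def
        by (simp only: D_add E.jordan_P_add mem)
          (simp only: E.M.a_ac closed)
    qed
    finally show ?thesis .
  qed
  have D_iff: "D X Y = \<zero>\<^bsub>E\<^esub>
      \<longleftrightarrow> ((X \<otimes>\<^bsub>E\<^esub> X) \<otimes>\<^bsub>E\<^esub> Y) \<otimes>\<^bsub>E\<^esub> X = (X \<otimes>\<^bsub>E\<^esub> X) \<otimes>\<^bsub>E\<^esub> (Y \<otimes>\<^bsub>E\<^esub> X)"
    if "X \<in> carrier E" "Y \<in> carrier E" for X Y
    using that unfolding D_def by (rule E.associator_square_eq_zero_iff)
  have AA: "D (?A a) (?A b) = \<zero>\<^bsub>E\<^esub>" if "a \<in> carrier A" "b \<in> carrier A" for a b
    using that jordan_algebra.jordan_identity[OF assms(1)]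
    by (simp add: D_iff)
  have AV: "D (?A a) (?V y) = \<zero>\<^bsub>E\<^esub>
      \<longleftrightarrow> a \<otimes>\<^bsub>A\<^esub> r (y, a \<otimes>\<^bsub>A\<^esub> a) = (a \<otimes>\<^bsub>A\<^esub> a) \<otimes>\<^bsub>A\<^esub> r (y, a)"
    if "a \<in> carrier A" "y \<in> carrier V" for a y
    using that by (simp add: D_iff A.prod_commute[of a "r (y, _)"])
  have VA: "D (?V x) (?A b) = \<zero>\<^bsub>E\<^esub>
      \<longleftrightarrow> r (x, f (x, x) \<otimes>\<^bsub>A\<^esub> b) \<oplus>\<^bsub>A\<^esub> r (x, r (x \<otimes>\<^bsub>V\<^esub> x, b))
        = f (x, x) \<otimes>\<^bsub>A\<^esub> r (x, b) \<oplus>\<^bsub>A\<^esub> r (x \<otimes>\<^bsub>V\<^esub> x, r (x, b))"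
    if "b \<in> carrier A" "x \<in> carrier V" for b x
    using that by (simp add: D_iff r_add)
  have VV: "D (?V x) (?V y) = \<zero>\<^bsub>E\<^esub>
      \<longleftrightarrow> r (x, r (y, f (x, x))) \<oplus>\<^bsub>A\<^esub> r (x, f (x \<otimes>\<^bsub>V\<^esub> x, y)) \<oplus>\<^bsub>A\<^esub> f ((x \<otimes>\<^bsub>V\<^esub> x) \<otimes>\<^bsub>V\<^esub> y, x)
        = f (x, x) \<otimes>\<^bsub>A\<^esub> f (x, y) \<oplus>\<^bsub>A\<^esub> r (x \<otimes>\<^bsub>V\<^esub> x, f (x, y))
          \<oplus>\<^bsub>A\<^esub> r (x \<otimes>\<^bsub>V\<^esub> y, f (x, x)) \<oplus>\<^bsub>A\<^esub> f (x \<otimes>\<^bsub>V\<^esub> x, x \<otimes>\<^bsub>V\<^esub> y)"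
    if "x \<in> carrier V" "y \<in> carrier V" for x y
    using that jordan_algebra.jordan_identity[OF assms(2)]
    by (simp add: D_iff r_add f_commute[of y x] V.prod_commute[of y x])
  have "CP2 A V r \<longleftrightarrow> (\<forall>a\<in>carrier A. \<forall>y\<in>carrier V. D (?A a) (?V y) = \<zero>\<^bsub>E\<^esub>)"
    by (simp add: CP2_def AV)
  moreover have "CP3 A V r f \<longleftrightarrow> (\<forall>b\<in>carrier A. \<forall>x\<in>carrier V. D (?V x) (?A b) = \<zero>\<^bsub>E\<^esub>)"
    by (simp add: CP3_def VA)
  moreover have "CP4 A V r f \<longleftrightarrow> (\<forall>x\<in>carrier V. \<forall>y\<in>carrier V. D (?V x) (?V y) = \<zero>\<^bsub>E\<^esub>)"
    by (simp add: CP4_def VV)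
  moreover have "CP5 A V r f \<longleftrightarrow>
      (\<forall>a\<in>carrier A. \<forall>b\<in>carrier A. \<forall>x\<in>carrier V. \<forall>y\<in>carrier V. S a b x y = \<zero>\<^bsub>E\<^esub>)"
    by (simp add: CP5_def S_def Let_def)
  moreover have "(\<forall>X\<in>carrier E. \<forall>Y\<in>carrier E. D X Y = \<zero>\<^bsub>E\<^esub>) \<longleftrightarrow>
      (\<forall>a\<in>carrier A. \<forall>y\<in>carrier V. D (?A a) (?V y) = \<zero>\<^bsub>E\<^esub>)
      \<and> (\<forall>b\<in>carrier A. \<forall>x\<in>carrier V. D (?V x) (?A b) = \<zero>\<^bsub>E\<^esub>)
      \<and> (\<forall>x\<in>carrier V. \<forall>y\<in>carrier V. D (?V x) (?V y) = \<zero>\<^bsub>E\<^esub>)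
      \<and> (\<forall>a\<in>carrier A. \<forall>b\<in>carrier A. \<forall>x\<in>carrier V. \<forall>y\<in>carrier V. S a b x y = \<zero>\<^bsub>E\<^esub>)"
    (is "?L \<longleftrightarrow> ?R")
  proof
    assume L: ?L
    \<comment> \<open>The four pure terms are instances of this with zero coordinates, so the
      decomposition leaves \<open>S\<close> alone.\<close>
    have D0: "D (a, x) (b, y) = \<zero>\<^bsub>E\<^esub>"
      if "a \<in> carrier A" "b \<in> carrier A" "x \<in> carrier V" "y \<in> carrier V" for a b x y
      using L that by simp
    have "S a b x y = \<zero>\<^bsub>E\<^esub>"
      if "a \<in> carrier A" "b \<in> carrier A" "x \<in> carrier V" "y \<in> carrier V" for a b x y
      using split[OF that] D0 that S_closed[OF that] by simp
    then show ?R using D0 by simp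
  next
    assume ?R
    then have "D (a, x) (b, y) = \<zero>\<^bsub>E\<^esub>"
      if "a \<in> carrier A" "b \<in> carrier A" "x \<in> carrier V" "y \<in> carrier V" for a b x y
      using that AA by (subst split) simp_all
    then show ?L by (auto simp: E_carrier)
  qed
  ultimately show ?thesis using jordan by simp
qed

end

section \<open>Extensions\<close>

lemma jordan_morphismsD:
  assumes "h \<in> jordan_morphisms K M N"
  shows "h \<in> linear_maps K M N"
    and "\<lbrakk>x \<in> carrier M; y \<in> carrier M\<rbrakk> \<Longrightarrow> h (x \<otimes>\<^bsub>M\<^esub> y) = h x \<otimes>\<^bsub>N\<^esub> h y"
  using assms by (auto simp: jordan_morphisms_def)

lemma jordan_morphisms_id: "(\<lambda>x. x) \<in> jordan_morphisms K M M"
  by (auto simp: jordan_morphisms_def linear_maps_def)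

lemma jordan_morphisms_comp:
  assumes "g \<in> jordan_morphisms K M N" "h \<in> jordan_morphisms K N P"
  shows "(\<lambda>x. h (g x)) \<in> jordan_morphisms K M P"
  using assms by (auto simp: jordan_morphisms_def linear_maps_def Pi_iff)

lemma jordan_morphisms_inv_into:
  assumes "comm_algebra K M" and g: "g \<in> jordan_morphisms K M N"
    and bij: "bij_betw g (carrier M) (carrier N)"
  shows "inv_into (carrier M) g \<in> jordan_morphisms K N M"
proof -
  interpret M: comm_algebra K M by fact
  note lin = jordan_morphismsD(1)[OF g]
  have g_inv: "g (inv_into (carrier M) g y) = y"
    and inv_closed: "inv_into (carrier M) g y \<in> carrier M" if "y \<in> carrier N" for y
    using bij that by (auto simp: bij_betw_def f_inv_into_f inv_into_into)
  have inv_eq: "inv_into (carrier M) g y = x" if "x \<in> carrier M" "g x = y" for x y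
    using bij that by (auto simp: bij_betw_def)
  have "inv_into (carrier M) g \<in> linear_maps K N M"
    by (rule linear_mapsI)
      (auto simp: g_inv inv_closed linear_maps_add[OF lin] linear_maps_smult[OF lin] intro!: inv_eq)
  then show ?thesis
    by (auto simp: jordan_morphisms_def g_inv inv_closed jordan_morphismsD(2)[OF g] intro!: inv_eq)
qed

text \<open>The identity can be checked after an injective morphism. This will yield (CP2) to (CP5)
  for the system attached to a section without computing with them.\<close>

lemma jordan_algebra_if_embeds:
  assumes "comm_algebra K M" "jordan_algebra K N" and g: "g \<in> jordan_morphisms K M N"
    and inj: "inj_on g (carrier M)"
  shows "jordan_algebra K M"
proof -
  interpret M: comm_algebra K M by fact
  note g_closed = linear_maps_closed[OF jordan_morphismsD(1)[OF g]]
  have "((a \<otimes>\<^bsub>M\<^esub> a) \<otimes>\<^bsub>M\<^esub> b) \<otimes>\<^bsub>M\<^esub> a = (a \<otimes>\<^bsub>M\<^esub> a) \<otimes>\<^bsub>M\<^esub> (b \<otimes>\<^bsub>M\<^esub> a)"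
    if "a \<in> carrier M" "b \<in> carrier M" for a b
  proof (rule inj_onD[OF inj])
    show "g (((a \<otimes>\<^bsub>M\<^esub> a) \<otimes>\<^bsub>M\<^esub> b) \<otimes>\<^bsub>M\<^esub> a) = g ((a \<otimes>\<^bsub>M\<^esub> a) \<otimes>\<^bsub>M\<^esub> (b \<otimes>\<^bsub>M\<^esub> a))"
      using that
      by (simp add: jordan_morphismsD(2)[OF g] jordan_algebra.jordan_identity[OF assms(2)] g_closed)
  qed (use that in auto)
  then show ?thesis
    by (simp add: M.jordan_algebra_iff M.associator_square_eq_zero_iff)
qed

section \<open>Exactness in terms of elements, and the cohomology relation on extensions\<close>

lemma extensionsD:
  assumes "(E, i, p) \<in> extensions K V A"
  shows "jordan_algebra K E" "i \<in> jordan_morphisms K A E" "p \<in> jordan_morphisms K E V"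
    and "a_kernel A E i = {\<zero>\<^bsub>A\<^esub>}" "p ` carrier E = carrier V"
    and "a \<in> carrier A \<Longrightarrow> p (i a) = \<zero>\<^bsub>V\<^esub>"
    and "\<lbrakk>e \<in> carrier E; p e = \<zero>\<^bsub>V\<^esub>\<rbrakk> \<Longrightarrow> \<exists>a\<in>carrier A. e = i a"
proof -
  have exact: "i ` carrier A = {e \<in> carrier E. p e = \<zero>\<^bsub>V\<^esub>}"
    using assms by (auto simp: extensions_def a_kernel_def')
  show "a \<in> carrier A \<Longrightarrow> p (i a) = \<zero>\<^bsub>V\<^esub>" using exact by blast
  show "\<exists>a\<in>carrier A. e = i a" if "e \<in> carrier E" "p e = \<zero>\<^bsub>V\<^esub>"
  proof -
    have "e \<in> i ` carrier A" using exact that by simp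
    then show ?thesis by blast
  qed
qed (use assms in \<open>auto simp: extensions_def\<close>)

lemma cohomologous_ext_refl: "cohomologous_ext K V A S S"
  using jordan_morphisms_id by (fastforce simp: cohomologous_ext_def split: prod.split)

text \<open>The three extensions may have different carrier types, which is needed to compare an
  arbitrary extension with crossed products.\<close>

lemma cohomologous_ext_trans:
  assumes "cohomologous_ext K V A S T" "cohomologous_ext K V A T U"
  shows "cohomologous_ext K V A S U"
proof -
  obtain E i p E' i' p' E'' i'' p'' where STU: "S = (E, i, p)" "T = (E', i', p')" "U = (E'', i'', p'')"
    by (cases S; cases T; cases U)
  obtain g where g: "g \<in> jordan_morphisms K E E'"
      "\<And>a. a \<in> carrier A \<Longrightarrow> g (i a) = i' a" "\<And>e. e \<in> carrier E \<Longrightarrow> p' (g e) = p e"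
    using assms(1) by (auto simp: STU cohomologous_ext_def)
  obtain h where h: "h \<in> jordan_morphisms K E' E''"
      "\<And>a. a \<in> carrier A \<Longrightarrow> h (i' a) = i'' a" "\<And>e. e \<in> carrier E' \<Longrightarrow> p'' (h e) = p' e"
    using assms(2) by (auto simp: STU cohomologous_ext_def)
  show ?thesis
    using jordan_morphisms_comp[OF g(1) h(1)] g h
      linear_maps_closed[OF jordan_morphismsD(1)[OF g(1)]]
    by (auto simp: STU cohomologous_ext_def intro!: bexI[of _ "\<lambda>x. h (g x)"])
qed

text \<open>This is the short five lemma.\<close>

lemma extension_morphism_bij_betw:
  assumes "module K A" "module K V"
    and S: "(E, i, p) \<in> extensions K V A" and T: "(E', i', p') \<in> extensions K V A"
    and g: "g \<in> jordan_morphisms K E E'"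
    and gi: "\<And>a. a \<in> carrier A \<Longrightarrow> g (i a) = i' a"
    and pg: "\<And>e. e \<in> carrier E \<Longrightarrow> p' (g e) = p e"
  shows "bij_betw g (carrier E) (carrier E')"
proof -
  interpret A: module K A by fact
  interpret E: comm_algebra K E by (rule jordan_algebra_imp_comm_algebra[OF extensionsD(1)[OF S]])
  interpret E': comm_algebra K E' by (rule jordan_algebra_imp_comm_algebra[OF extensionsD(1)[OF T]])
  interpret V: module K V by fact
  note glin = jordan_morphismsD(1)[OF g]
  note ilin = jordan_morphismsD(1)[OF extensionsD(2)[OF S]]
    and plin' = jordan_morphismsD(1)[OF extensionsD(3)[OF T]]
  have "inj_on g (carrier E)"
  proof (rule linear_maps_inj_on[OF E.is_module E'.is_module glin E.carrier_is_submodule])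
    fix e assume e: "e \<in> carrier E" "g e = \<zero>\<^bsub>E'\<^esub>"
    have "p e = \<zero>\<^bsub>V\<^esub>"
      using pg[OF e(1)] e(2) linear_maps_zero[OF E'.is_module assms(2) plin'] by simp
    then obtain a where a: "a \<in> carrier A" "e = i a" using extensionsD(7)[OF S] e by blast
    \<comment> \<open>Since \<open>g\<close> extends \<open>i'\<close> along \<open>i\<close>, an
      element of \<open>A\<close> killed by \<open>g\<close> after \<open>i\<close> is killed by the
      injective \<open>i'\<close>.\<close>
    have "a \<in> a_kernel A E' i'" using a e gi[of a] by (simp add: a_kernel_def')
    then have "a = \<zero>\<^bsub>A\<^esub>" by (simp add: extensionsD(4)[OF T])
    then show "e = \<zero>\<^bsub>E\<^esub>" using a linear_maps_zero[OF assms(1) E.is_module ilin] by simp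
  qed
  moreover have "e' \<in> g ` carrier E" if e': "e' \<in> carrier E'" for e'
  proof -
    have "p' e' \<in> p ` carrier E"
      using linear_maps_closed[OF plin' e'] extensionsD(5)[OF S] by simp
    \<comment> \<open>\<open>g e\<close> and \<open>e'\<close> agree in \<open>V\<close>, so they
      differ by an element of \<open>A\<close>; adding that element to \<open>e\<close> corrects the
      preimage.\<close>
    then obtain e where e: "e \<in> carrier E" "p e = p' e'" by auto
    have ge: "g e \<in> carrier E'" using linear_maps_closed[OF glin] e by blast
    have "p' (e' \<ominus>\<^bsub>E'\<^esub> g e) = \<zero>\<^bsub>V\<^esub>"
      using linear_maps_minus[OF E'.is_module assms(2) plin' e' ge] pg e
        linear_maps_closed[OF plin' e'] by (simp add: V.M.minus_eq_zero_iff)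
    then obtain a where a: "a \<in> carrier A" "e' \<ominus>\<^bsub>E'\<^esub> g e = i' a"
      using extensionsD(7)[OF T, of "e' \<ominus>\<^bsub>E'\<^esub> g e"] e' ge by auto
    have "g (i a \<oplus>\<^bsub>E\<^esub> e) = (e' \<ominus>\<^bsub>E'\<^esub> g e) \<oplus>\<^bsub>E'\<^esub> g e"
      using a e gi by (simp add: linear_maps_add[OF glin] linear_maps_closed[OF ilin])
    also have "\<dots> = e'" using e' ge by (simp add: a_minus_def E'.M.a_assoc E'.M.l_neg)
    finally show ?thesis
      using a e linear_maps_closed[OF ilin] by (metis E.M.a_closed image_eqI)
  qed
  ultimately show ?thesis using linear_maps_closed[OF glin] by (auto simp: bij_betw_def)
qed

text \<open>The relation asks only for a morphism in one direction, but the five lemma makes it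
  bijective, and its inverse is again a morphism compatible with \<open>A\<close> and
  \<open>V\<close>.\<close>

lemma cohomologous_ext_sym:
  assumes "module K A" "module K V" "S \<in> extensions K V A" "T \<in> extensions K V A"
    and "cohomologous_ext K V A S T"
  shows "cohomologous_ext K V A T S"
proof -
  obtain E i p E' i' p' where ST: "S = (E, i, p)" "T = (E', i', p')"
    by (cases S; cases T)
  note S = assms(3)[unfolded ST] and T = assms(4)[unfolded ST]
  obtain g where g: "g \<in> jordan_morphisms K E E'"
      "\<And>a. a \<in> carrier A \<Longrightarrow> g (i a) = i' a" "\<And>e. e \<in> carrier E \<Longrightarrow> p' (g e) = p e"
    using assms(5) by (auto simp: ST cohomologous_ext_def)
  note bij = extension_morphism_bij_betw[OF assms(1,2) S T g]
  let ?h = "inv_into (carrier E) g"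
  have "?h \<in> jordan_morphisms K E' E"
    by (rule jordan_morphisms_inv_into[OF jordan_algebra_imp_comm_algebra[OF extensionsD(1)[OF S]] g(1) bij])
  moreover have "?h (i' a) = i a" if "a \<in> carrier A" for a
    using bij g(2)[OF that] linear_maps_closed[OF jordan_morphismsD(1)[OF extensionsD(2)[OF S]] that]
    by (metis bij_betw_inv_into_left)
  moreover have "p (?h e) = p' e" if "e \<in> carrier E'" for e
    using g(3)[of "?h e"] bij that
    by (metis bij_betw_def bij_betw_inv_into_right inv_into_into)
  ultimately show ?thesis by (auto simp: ST cohomologous_ext_def)
qed

lemma equiv_ext_rel:
  assumes "module K A" "module K V"
  shows "equiv (extensions K V A) (ext_rel K V A)"
proof (rule equivI)
  show "ext_rel K V A \<subseteq> extensions K V A \<times> extensions K V A" by (auto simp: ext_rel_def)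
  show "refl_on (extensions K V A) (ext_rel K V A)"
    by (auto simp: refl_on_def ext_rel_def cohomologous_ext_refl)
  show "sym (ext_rel K V A)"
    using cohomologous_ext_sym[OF assms] by (auto simp: sym_def ext_rel_def)
  show "trans (ext_rel K V A)"
    unfolding trans_def ext_rel_def using cohomologous_ext_trans by blast
qed

section \<open>Crossed systems and extensions\<close>

lemma crossed_datum_if_crossed_systems:
  assumes "jordan_algebra K A" "jordan_algebra K V" "(r, f) \<in> crossed_systems K A V"
  shows "crossed_datum K A V r f"
  using assms
  by (auto simp: crossed_systems_def crossed_datum_def crossed_datum_axioms_def
      intro: jordan_algebra_imp_comm_algebra)

lemma crossed_ext_in_extensions:
  assumes "jordan_algebra K A" "jordan_algebra K V" "c \<in> crossed_systems K A V"
  shows "crossed_ext A V c \<in> extensions K V A"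
proof -
  obtain r f where c: "c = (r, f)" by (cases c)
  interpret crossed_datum K A V r f
    by (rule crossed_datum_if_crossed_systems) (use assms c in auto)
  have "jordan_algebra K E"
    using assms(3) by (simp add: jordan_crossed_product_iff[OF assms(1,2)] c crossed_systems_def)
  moreover have "(\<lambda>a. (a, \<zero>\<^bsub>V\<^esub>)) \<in> jordan_morphisms K A E"
    by (auto simp: jordan_morphisms_def linear_maps_def)
  moreover have "(\<lambda>(a, x). x) \<in> jordan_morphisms K E V"
    by (auto simp: jordan_morphisms_def linear_maps_def E_carrier)
  moreover have "(\<lambda>a. (a, \<zero>\<^bsub>V\<^esub>)) ` carrier A = a_kernel E V (\<lambda>(a, x). x)"
    by (auto simp: a_kernel_def' E_carrier)
  moreover have "(\<lambda>(a, x). x) ` carrier E = carrier V"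
    by (force simp: E_carrier)
  ultimately show ?thesis
    by (auto simp: extensions_def crossed_ext_def c a_kernel_def' E_zero)
qed

text \<open>The additive core of the formula for \<open>f'\<close>. Here \<open>g\<close> is
  \<open>f (x, y)\<close> plus \<open>h\<close> of the product of \<open>x\<close> and
  \<open>y\<close>, \<open>q\<close> is the product of \<open>h x\<close> and \<open>h y\<close>,
  \<open>u\<close> and \<open>v\<close> are \<open>r' (x, h y)\<close> and
  \<open>r' (y, h x)\<close>, and \<open>w\<close> is \<open>f' (x, y)\<close>. Each unprimed action
  contributes one subtracted \<open>q\<close>, of which one cancels the added
  \<open>q\<close>.\<close>

lemma (in abelian_group) coboundary_solve:
  assumes "g \<in> carrier G" "q \<in> carrier G" "u \<in> carrier G" "v \<in> carrier G" "w \<in> carrier G"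
  shows "w = g \<oplus> q \<ominus> (u \<oplus> q) \<ominus> (v \<oplus> q) \<longleftrightarrow> g = q \<oplus> u \<oplus> v \<oplus> w"
proof -
  have "w = g \<oplus> q \<ominus> (u \<oplus> q) \<ominus> (v \<oplus> q) \<longleftrightarrow> g \<oplus> q = w \<oplus> (v \<oplus> q) \<oplus> (u \<oplus> q)"
    using assms by (simp add: a_minus_def add.inv_solve_right add.inv_solve_right')
  also have "w \<oplus> (v \<oplus> q) \<oplus> (u \<oplus> q) = (q \<oplus> u \<oplus> v \<oplus> w) \<oplus> q"
    using assms by (simp add: a_ac)
  also have "g \<oplus> q = (q \<oplus> u \<oplus> v \<oplus> w) \<oplus> q \<longleftrightarrow> g = q \<oplus> u \<oplus> v \<oplus> w"
    using assms by simp
  finally show ?thesis .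
qed

text \<open>
  The morphisms of extensions between two crossed products are the maps \<open>(a, x) \<mapsto> (a + h x, x)\<close>
  with \<open>h\<close> linear. The right-hand side is what multiplicativity of such a map says; eliminating
  the unprimed action turns the cohomology relation into this subtraction-free form.
\<close>

lemma crossed_systems_relation_iff:
  assumes "crossed_datum K A V r f" "crossed_datum K A V r' f'" "h \<in> linear_maps K V A"
  shows "((\<forall>x\<in>carrier V. \<forall>a\<in>carrier A. r' (x, a) = r (x, a) \<ominus>\<^bsub>A\<^esub> a \<otimes>\<^bsub>A\<^esub> h x)
      \<and> (\<forall>x\<in>carrier V. \<forall>y\<in>carrier V.
           f' (x, y) = f (x, y) \<oplus>\<^bsub>A\<^esub> h (x \<otimes>\<^bsub>V\<^esub> y) \<oplus>\<^bsub>A\<^esub> h x \<otimes>\<^bsub>A\<^esub> h y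
                       \<ominus>\<^bsub>A\<^esub> r (x, h y) \<ominus>\<^bsub>A\<^esub> r (y, h x)))
    \<longleftrightarrow> (\<forall>x\<in>carrier V. \<forall>a\<in>carrier A. r (x, a) = r' (x, a) \<oplus>\<^bsub>A\<^esub> a \<otimes>\<^bsub>A\<^esub> h x)
      \<and> (\<forall>x\<in>carrier V. \<forall>y\<in>carrier V. f (x, y) \<oplus>\<^bsub>A\<^esub> h (x \<otimes>\<^bsub>V\<^esub> y)
           = h x \<otimes>\<^bsub>A\<^esub> h y \<oplus>\<^bsub>A\<^esub> r' (x, h y) \<oplus>\<^bsub>A\<^esub> r' (y, h x) \<oplus>\<^bsub>A\<^esub> f' (x, y))"
    (is "?R \<and> ?F \<longleftrightarrow> ?R' \<and> ?F'")
proof -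
  interpret C: crossed_datum K A V r f by fact
  interpret D: crossed_datum K A V r' f' by fact
  note h_closed [simp] = linear_maps_closed[OF assms(3)]
  have RR: "?R \<longleftrightarrow> ?R'"
    by (simp add: a_minus_def C.A.M.add.inv_solve_right)
  moreover have "?F \<longleftrightarrow> ?F'" if ?R'
  proof -
    have "f' (x, y) = f (x, y) \<oplus>\<^bsub>A\<^esub> h (x \<otimes>\<^bsub>V\<^esub> y) \<oplus>\<^bsub>A\<^esub> h x \<otimes>\<^bsub>A\<^esub> h y
          \<ominus>\<^bsub>A\<^esub> r (x, h y) \<ominus>\<^bsub>A\<^esub> r (y, h x)
      \<longleftrightarrow> f (x, y) \<oplus>\<^bsub>A\<^esub> h (x \<otimes>\<^bsub>V\<^esub> y)
          = h x \<otimes>\<^bsub>A\<^esub> h y \<oplus>\<^bsub>A\<^esub> r' (x, h y) \<oplus>\<^bsub>A\<^esub> r' (y, h x) \<oplus>\<^bsub>A\<^esub> f' (x, y)"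
      if xy: "x \<in> carrier V" "y \<in> carrier V" for x y
    proof -
      have "r (x, h y) = r' (x, h y) \<oplus>\<^bsub>A\<^esub> h x \<otimes>\<^bsub>A\<^esub> h y" "r (y, h x) = r' (y, h x) \<oplus>\<^bsub>A\<^esub> h x \<otimes>\<^bsub>A\<^esub> h y"
        using \<open>?R'\<close> xy C.A.prod_commute[of "h x" "h y"] by simp_all
      then show ?thesis using xy by (simp only:) (simp add: C.A.M.coboundary_solve)
    qed
    then show ?thesis by simp
  qed
  ultimately show ?thesis by blast
qed

text \<open>A morphism inducing the identity on \<open>A\<close> and on \<open>V\<close> is
  determined by its values on the copy of \<open>V\<close>, and the \<open>A\<close>-coordinate of
  these values is the linear map that the cohomology formulas ask for.\<close>

lemma cohomologous_systems_iff:
  assumes "jordan_algebra K A" "jordan_algebra K V"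
    and "c \<in> crossed_systems K A V" "c' \<in> crossed_systems K A V"
  shows "(c, c') \<in> cohomologous_systems K A V
    \<longleftrightarrow> cohomologous_ext K V A (crossed_ext A V c) (crossed_ext A V c')"
proof -
  obtain r f r' f' where c: "c = (r, f)" "c' = (r', f')" by (cases c; cases c')
  have datum: "crossed_datum K A V r f" and datum': "crossed_datum K A V r' f'"
    using crossed_datum_if_crossed_systems assms c by blast+
  interpret C: crossed_datum K A V r f by fact
  interpret D: crossed_datum K A V r' f' by fact
  let ?rel = "\<lambda>h. (\<forall>x\<in>carrier V. \<forall>a\<in>carrier A. r (x, a) = r' (x, a) \<oplus>\<^bsub>A\<^esub> a \<otimes>\<^bsub>A\<^esub> h x)
      \<and> (\<forall>x\<in>carrier V. \<forall>y\<in>carrier V. f (x, y) \<oplus>\<^bsub>A\<^esub> h (x \<otimes>\<^bsub>V\<^esub> y)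
           = h x \<otimes>\<^bsub>A\<^esub> h y \<oplus>\<^bsub>A\<^esub> r' (x, h y) \<oplus>\<^bsub>A\<^esub> r' (y, h x) \<oplus>\<^bsub>A\<^esub> f' (x, y))"
  have "(c, c') \<in> cohomologous_systems K A V \<longleftrightarrow> (\<exists>h\<in>linear_maps K V A. ?rel h)"
    using assms(3,4) crossed_systems_relation_iff[OF datum datum']
    by (simp add: cohomologous_systems_def c cong: bex_cong)
  also have "\<dots> \<longleftrightarrow> (\<exists>\<phi>\<in>jordan_morphisms K C.E D.E.
      (\<forall>a\<in>carrier A. \<phi> (a, \<zero>\<^bsub>V\<^esub>) = (a, \<zero>\<^bsub>V\<^esub>)) \<and> (\<forall>e\<in>carrier C.E. snd (\<phi> e) = snd e))"
    (is "_ \<longleftrightarrow> (\<exists>\<phi>\<in>_. ?over \<phi>)")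
  proof
    assume "\<exists>h\<in>linear_maps K V A. ?rel h"
    then obtain h where h: "h \<in> linear_maps K V A"
      and rh: "\<And>x a. \<lbrakk>x \<in> carrier V; a \<in> carrier A\<rbrakk> \<Longrightarrow> r (x, a) = r' (x, a) \<oplus>\<^bsub>A\<^esub> a \<otimes>\<^bsub>A\<^esub> h x"
      and fh: "\<And>x y. \<lbrakk>x \<in> carrier V; y \<in> carrier V\<rbrakk> \<Longrightarrow> f (x, y) \<oplus>\<^bsub>A\<^esub> h (x \<otimes>\<^bsub>V\<^esub> y)
           = h x \<otimes>\<^bsub>A\<^esub> h y \<oplus>\<^bsub>A\<^esub> r' (x, h y) \<oplus>\<^bsub>A\<^esub> r' (y, h x) \<oplus>\<^bsub>A\<^esub> f' (x, y)"
      by auto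
    note h_closed [simp] = linear_maps_closed[OF h]
    note h_zero [simp] = linear_maps_zero[OF C.V.is_module C.A.is_module h]
    define \<phi> where "\<phi> = (\<lambda>(a, x). (a \<oplus>\<^bsub>A\<^esub> h x, x))"
    have "\<phi> \<in> linear_maps K C.E D.E"
      by (rule linear_mapsI)
        (auto simp: \<phi>_def C.E_carrier D.E_carrier linear_maps_add[OF h] linear_maps_smult[OF h]
          C.A.smult_r_distr C.A.M.a_ac)
    moreover have "\<phi> (u \<otimes>\<^bsub>C.E\<^esub> v) = \<phi> u \<otimes>\<^bsub>D.E\<^esub> \<phi> v" if uv: "u \<in> carrier C.E" "v \<in> carrier C.E" for u v
    proof -
      obtain a x b y where eq: "u = (a, x)" "v = (b, y)" by (cases u; cases v)
      then have [simp]: "a \<in> carrier A" "b \<in> carrier A" "x \<in> carrier V" "y \<in> carrier V"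
        using uv by auto
      have "a \<otimes>\<^bsub>A\<^esub> b \<oplus>\<^bsub>A\<^esub> r (x, b) \<oplus>\<^bsub>A\<^esub> r (y, a) \<oplus>\<^bsub>A\<^esub> f (x, y) \<oplus>\<^bsub>A\<^esub> h (x \<otimes>\<^bsub>V\<^esub> y)
        = a \<otimes>\<^bsub>A\<^esub> b \<oplus>\<^bsub>A\<^esub> r (x, b) \<oplus>\<^bsub>A\<^esub> r (y, a) \<oplus>\<^bsub>A\<^esub> (f (x, y) \<oplus>\<^bsub>A\<^esub> h (x \<otimes>\<^bsub>V\<^esub> y))"
        by (simp add: C.A.M.a_assoc)
      \<comment> \<open>The cross terms \<open>a \<otimes> h y\<close> and
        \<open>b \<otimes> h x\<close> turn the primed actions on \<open>a\<close> and
        \<open>b\<close> into the unprimed ones; all terms free of \<open>a\<close> and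
        \<open>b\<close> are collected by \<open>fh\<close>.\<close>
      also have "\<dots> = (a \<oplus>\<^bsub>A\<^esub> h x) \<otimes>\<^bsub>A\<^esub> (b \<oplus>\<^bsub>A\<^esub> h y) \<oplus>\<^bsub>A\<^esub> r' (x, b \<oplus>\<^bsub>A\<^esub> h y)
          \<oplus>\<^bsub>A\<^esub> r' (y, a \<oplus>\<^bsub>A\<^esub> h x) \<oplus>\<^bsub>A\<^esub> f' (x, y)"
        using C.A.prod_commute[of b "h x"]
        by (simp add: rh fh D.r_add C.A.prod_add_left C.A.prod_add_right C.A.M.a_ac)
      finally show ?thesis by (simp add: eq \<phi>_def)
    qed
    ultimately have "\<phi> \<in> jordan_morphisms K C.E D.E" by (simp add: jordan_morphisms_def)
    moreover have "?over \<phi>" by (auto simp: \<phi>_def C.E_carrier)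
    ultimately show "\<exists>\<phi>\<in>jordan_morphisms K C.E D.E. ?over \<phi>" by blast
  next
    assume "\<exists>\<phi>\<in>jordan_morphisms K C.E D.E. ?over \<phi>"
    then obtain \<phi> where \<phi>: "\<phi> \<in> jordan_morphisms K C.E D.E"
      and \<phi>A: "\<And>a. a \<in> carrier A \<Longrightarrow> \<phi> (a, \<zero>\<^bsub>V\<^esub>) = (a, \<zero>\<^bsub>V\<^esub>)"
      and \<phi>V: "\<And>e. e \<in> carrier C.E \<Longrightarrow> snd (\<phi> e) = snd e"
      by blast
    note lin = jordan_morphismsD(1)[OF \<phi>]
    define h where "h x = fst (\<phi> (\<zero>\<^bsub>A\<^esub>, x))" for x
    have \<phi>0: "\<phi> (\<zero>\<^bsub>A\<^esub>, x) = (h x, x)" if "x \<in> carrier V" for x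
      using \<phi>V[of "(\<zero>\<^bsub>A\<^esub>, x)"] that by (simp add: h_def prod_eq_iff)
    have h_closed [simp]: "h x \<in> carrier A" if "x \<in> carrier V" for x
      using linear_maps_closed[OF lin, of "(\<zero>\<^bsub>A\<^esub>, x)"] that by (simp add: \<phi>0)
    have \<phi>_eq: "\<phi> (a, x) = (a \<oplus>\<^bsub>A\<^esub> h x, x)" if "a \<in> carrier A" "x \<in> carrier V" for a x
      using linear_maps_add[OF lin, of "(a, \<zero>\<^bsub>V\<^esub>)" "(\<zero>\<^bsub>A\<^esub>, x)"] that by (simp add: \<phi>0 \<phi>A)
    have "h \<in> linear_maps K V A"
    proof (rule linear_mapsI)
      show "h (x \<oplus>\<^bsub>V\<^esub> y) = h x \<oplus>\<^bsub>A\<^esub> h y" if "x \<in> carrier V" "y \<in> carrier V" for x y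
        using linear_maps_add[OF lin, of "(\<zero>\<^bsub>A\<^esub>, x)" "(\<zero>\<^bsub>A\<^esub>, y)"] that by (simp add: \<phi>0)
      show "h (t \<odot>\<^bsub>V\<^esub> x) = t \<odot>\<^bsub>A\<^esub> h x" if "t \<in> carrier K" "x \<in> carrier V" for t x
        using linear_maps_smult[OF lin, of t "(\<zero>\<^bsub>A\<^esub>, x)"] that by (simp add: \<phi>0)
    qed simp
    \<comment> \<open>Multiplicativity on a factor from \<open>A\<close> and one from
      \<open>V\<close> gives the formula for the action; on two factors from \<open>V\<close> it
      gives the formula for \<open>f\<close>.\<close>
    moreover have "r (x, a) = r' (x, a) \<oplus>\<^bsub>A\<^esub> a \<otimes>\<^bsub>A\<^esub> h x" if "x \<in> carrier V" "a \<in> carrier A" for x a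
      using jordan_morphismsD(2)[OF \<phi>, of "(a, \<zero>\<^bsub>V\<^esub>)" "(\<zero>\<^bsub>A\<^esub>, x)"] that
      by (simp add: \<phi>0 \<phi>A C.A.M.a_ac)
    moreover have "f (x, y) \<oplus>\<^bsub>A\<^esub> h (x \<otimes>\<^bsub>V\<^esub> y)
           = h x \<otimes>\<^bsub>A\<^esub> h y \<oplus>\<^bsub>A\<^esub> r' (x, h y) \<oplus>\<^bsub>A\<^esub> r' (y, h x) \<oplus>\<^bsub>A\<^esub> f' (x, y)"
      if "x \<in> carrier V" "y \<in> carrier V" for x y
      using jordan_morphismsD(2)[OF \<phi>, of "(\<zero>\<^bsub>A\<^esub>, x)" "(\<zero>\<^bsub>A\<^esub>, y)"] that
      by (simp add: \<phi>0 \<phi>_eq)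
    ultimately show "\<exists>h\<in>linear_maps K V A. ?rel h" by blast
  qed
  also have "\<dots> \<longleftrightarrow> cohomologous_ext K V A (crossed_ext A V c) (crossed_ext A V c')"
    by (simp add: cohomologous_ext_def crossed_ext_def c case_prod_unfold)
  finally show ?thesis .
qed

text \<open>
  A linear section \<open>s\<close> of the projection gives the crossed system \<open>x \<triangleright> a = s x \<cdot> a\<close>,
  \<open>f (x, y) = s x \<cdot> s y - s (x \<cdot> y)\<close>. Its crossed product is a Jordan algebra, whence it satisfies
  the crossed system axioms, because \<open>(a, x) \<mapsto> a + s x\<close> embeds it into the extension.
\<close>

lemma extension_cohomologous_to_crossed_ext:
  assumes jA: "jordan_algebra K A" and jV: "jordan_algebra K V" and S: "S \<in> extensions K V A"
  obtains c where "c \<in> crossed_systems K A V" "cohomologous_ext K V A (crossed_ext A V c) S"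
proof -
  obtain E i p where SE: "S = (E, i, p)" by (cases S)
  note Sx = S[unfolded SE]
  interpret A: comm_algebra K A by (rule jordan_algebra_imp_comm_algebra[OF jA])
  interpret V: comm_algebra K V by (rule jordan_algebra_imp_comm_algebra[OF jV])
  interpret E: comm_algebra K E by (rule jordan_algebra_imp_comm_algebra[OF extensionsD(1)[OF Sx]])
  note imult = jordan_morphismsD(2)[OF extensionsD(2)[OF Sx]]
    and pmult = jordan_morphismsD(2)[OF extensionsD(3)[OF Sx]]
    and ilin = jordan_morphismsD(1)[OF extensionsD(2)[OF Sx]]
    and plin = jordan_morphismsD(1)[OF extensionsD(3)[OF Sx]]
    and pi = extensionsD(6)[OF Sx]
  obtain s where slin: "s \<in> linear_maps K V E" and ps: "\<And>x. x \<in> carrier V \<Longrightarrow> p (s x) = x"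
    using linear_section_exists[OF A.is_field E.is_module V.is_module plin extensionsD(5)[OF Sx]]
    by blast
  note closed [simp] = linear_maps_closed[OF ilin] linear_maps_closed[OF plin] linear_maps_closed[OF slin]
  have inj: "inj_on i (carrier A)"
    by (rule linear_maps_inj_on_carrier[OF A.is_module E.is_module ilin extensionsD(4)[OF Sx]])
  \<comment> \<open>A preimage map for \<open>i\<close>, meaningful only on the kernel of
    \<open>p\<close>.\<close>
  define j where "j = inv_into (carrier A) i"
  have j: "j e \<in> carrier A" "i (j e) = e" if "e \<in> carrier E" "p e = \<zero>\<^bsub>V\<^esub>" for e
    using extensionsD(7)[OF Sx that] by (auto simp: j_def inv_into_into f_inv_into_f)
  \<comment> \<open>\<open>p\<close> kills \<open>s x \<otimes> i a\<close> because it kills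
    \<open>i a\<close>, and it kills the defect of multiplicativity of \<open>s\<close> because
    \<open>s\<close> is a section. Hence both arguments of \<open>j\<close> lie in the image of
    \<open>A\<close>. The restriction supplies the extensionality demanded of bilinear maps.\<close>
  define r where "r = restrict (\<lambda>(x, a). j (s x \<otimes>\<^bsub>E\<^esub> i a)) (carrier V \<times> carrier A)"
  define f where "f = restrict (\<lambda>(x, y). j (s x \<otimes>\<^bsub>E\<^esub> s y \<ominus>\<^bsub>E\<^esub> s (x \<otimes>\<^bsub>V\<^esub> y))) (carrier V \<times> carrier V)"
  have r: "r (x, a) \<in> carrier A" "i (r (x, a)) = s x \<otimes>\<^bsub>E\<^esub> i a"
    if "x \<in> carrier V" "a \<in> carrier A" for x a
    using that j[of "s x \<otimes>\<^bsub>E\<^esub> i a"] by (simp_all add: r_def pmult ps pi)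
  have f_mem: "f (x, y) \<in> carrier A"
    and f_eq: "i (f (x, y)) \<oplus>\<^bsub>E\<^esub> s (x \<otimes>\<^bsub>V\<^esub> y) = s x \<otimes>\<^bsub>E\<^esub> s y"
    if "x \<in> carrier V" "y \<in> carrier V" for x y
  proof -
    have "p (s x \<otimes>\<^bsub>E\<^esub> s y \<ominus>\<^bsub>E\<^esub> s (x \<otimes>\<^bsub>V\<^esub> y)) = \<zero>\<^bsub>V\<^esub>"
      using that
      by (simp add: linear_maps_minus[OF E.is_module V.is_module plin] pmult ps V.M.minus_eq_zero_iff)
    then have "f (x, y) \<in> carrier A \<and> i (f (x, y)) = s x \<otimes>\<^bsub>E\<^esub> s y \<ominus>\<^bsub>E\<^esub> s (x \<otimes>\<^bsub>V\<^esub> y)"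
      using that j by (simp add: f_def)
    then show "f (x, y) \<in> carrier A" "i (f (x, y)) \<oplus>\<^bsub>E\<^esub> s (x \<otimes>\<^bsub>V\<^esub> y) = s x \<otimes>\<^bsub>E\<^esub> s y"
      using that by (simp_all add: a_minus_def E.M.a_assoc E.M.l_neg)
  qed
  \<comment> \<open>This characterises \<open>f\<close> without subtraction and moves its additivity
    and homogeneity into \<open>E\<close>, where they follow from bilinearity of the
    product.\<close>
  have f_uniq: "f (x, y) = a"
    if "x \<in> carrier V" "y \<in> carrier V" "a \<in> carrier A" "i a \<oplus>\<^bsub>E\<^esub> s (x \<otimes>\<^bsub>V\<^esub> y) = s x \<otimes>\<^bsub>E\<^esub> s y" for x y a
  proof (rule inj_onD[OF inj])
    have "i (f (x, y)) \<oplus>\<^bsub>E\<^esub> s (x \<otimes>\<^bsub>V\<^esub> y) = i a \<oplus>\<^bsub>E\<^esub> s (x \<otimes>\<^bsub>V\<^esub> y)"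
      using that f_eq by simp
    then show "i (f (x, y)) = i a"
      by (subst (asm) E.M.add.right_cancel) (use that f_mem in auto)
  qed (use that f_mem in auto)
  have f_sym: "f (x, y) = f (y, x)" if "x \<in> carrier V" "y \<in> carrier V" for x y
    using that E.prod_commute[of "s x" "s y"] V.prod_commute[of x y] by (simp add: f_def)
  have r_bilin: "r \<in> bilinear_maps K V A A"
  proof (rule bilinear_mapsI)
    show "r \<in> extensional (carrier V \<times> carrier A)" by (simp add: r_def)
    show "(\<lambda>a. r (x, a)) \<in> linear_maps K A A" if "x \<in> carrier V" for x
      by (rule linear_mapsI)
        (use that in \<open>auto intro!: inj_onD[OF inj] simp: r linear_maps_add[OF ilin]
          linear_maps_smult[OF ilin] E.prod_add_right E.prod_smult_right\<close>)
    show "(\<lambda>x. r (x, a)) \<in> linear_maps K V A" if "a \<in> carrier A" for a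
      by (rule linear_mapsI)
        (use that in \<open>auto intro!: inj_onD[OF inj] simp: r linear_maps_add[OF ilin]
          linear_maps_smult[OF ilin] linear_maps_add[OF slin] linear_maps_smult[OF slin]
          E.prod_add_left E.prod_smult_left\<close>)
  qed
  have f_lin: "(\<lambda>x. f (x, y)) \<in> linear_maps K V A" if y: "y \<in> carrier V" for y
  proof (rule linear_mapsI)
    show "f (x, y) \<in> carrier A" if "x \<in> carrier V" for x using that y by (rule f_mem)
    show "f (x \<oplus>\<^bsub>V\<^esub> x', y) = f (x, y) \<oplus>\<^bsub>A\<^esub> f (x', y)" if x: "x \<in> carrier V" "x' \<in> carrier V" for x x'
    proof (rule f_uniq)
      have "i (f (x, y) \<oplus>\<^bsub>A\<^esub> f (x', y)) \<oplus>\<^bsub>E\<^esub> s ((x \<oplus>\<^bsub>V\<^esub> x') \<otimes>\<^bsub>V\<^esub> y)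
        = (i (f (x, y)) \<oplus>\<^bsub>E\<^esub> s (x \<otimes>\<^bsub>V\<^esub> y)) \<oplus>\<^bsub>E\<^esub> (i (f (x', y)) \<oplus>\<^bsub>E\<^esub> s (x' \<otimes>\<^bsub>V\<^esub> y))"
        using x y by (simp add: f_mem V.prod_add_left linear_maps_add[OF ilin]
            linear_maps_add[OF slin] E.M.a_ac)
      also have "\<dots> = s (x \<oplus>\<^bsub>V\<^esub> x') \<otimes>\<^bsub>E\<^esub> s y"
        using x y by (simp add: f_eq linear_maps_add[OF slin] E.prod_add_left)
      finally show "i (f (x, y) \<oplus>\<^bsub>A\<^esub> f (x', y)) \<oplus>\<^bsub>E\<^esub> s ((x \<oplus>\<^bsub>V\<^esub> x') \<otimes>\<^bsub>V\<^esub> y)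
        = s (x \<oplus>\<^bsub>V\<^esub> x') \<otimes>\<^bsub>E\<^esub> s y" .
    qed (use x y f_mem in auto)
    show "f (t \<odot>\<^bsub>V\<^esub> x, y) = t \<odot>\<^bsub>A\<^esub> f (x, y)" if x: "t \<in> carrier K" "x \<in> carrier V" for t x
    proof (rule f_uniq)
      have "i (t \<odot>\<^bsub>A\<^esub> f (x, y)) \<oplus>\<^bsub>E\<^esub> s ((t \<odot>\<^bsub>V\<^esub> x) \<otimes>\<^bsub>V\<^esub> y)
        = t \<odot>\<^bsub>E\<^esub> (i (f (x, y)) \<oplus>\<^bsub>E\<^esub> s (x \<otimes>\<^bsub>V\<^esub> y))"
        using x y by (simp add: f_mem V.prod_smult_left linear_maps_smult[OF ilin]
            linear_maps_smult[OF slin] E.smult_r_distr)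
      also have "\<dots> = s (t \<odot>\<^bsub>V\<^esub> x) \<otimes>\<^bsub>E\<^esub> s y"
        using x y by (simp add: f_eq linear_maps_smult[OF slin] E.prod_smult_left)
      finally show "i (t \<odot>\<^bsub>A\<^esub> f (x, y)) \<oplus>\<^bsub>E\<^esub> s ((t \<odot>\<^bsub>V\<^esub> x) \<otimes>\<^bsub>V\<^esub> y)
        = s (t \<odot>\<^bsub>V\<^esub> x) \<otimes>\<^bsub>E\<^esub> s y" .
    qed (use x y f_mem in auto)
  qed
  have f_bilin: "f \<in> bilinear_maps K V V A"
  proof (rule bilinear_mapsI)
    show "f \<in> extensional (carrier V \<times> carrier V)" by (simp add: f_def)
    \<comment> \<open>Linearity in the second argument is inherited from the first through
      symmetry.\<close>
    show "(\<lambda>y. f (x, y)) \<in> linear_maps K V A" if "x \<in> carrier V" for x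
      using f_lin[OF that] that by (simp add: linear_maps_def Pi_iff f_sym[of x])
  qed (rule f_lin)
  have cp1: "CP1 V f" using f_sym by (simp add: CP1_def)
  interpret C: crossed_datum K A V r f by unfold_locales (fact r_bilin f_bilin cp1)+
  interpret CE: comm_algebra K C.E by (rule C.comm_algebra_E)
  define \<phi> where "\<phi> = (\<lambda>(a, x). i a \<oplus>\<^bsub>E\<^esub> s x)"
  have p\<phi>: "p (\<phi> (a, x)) = x" if "a \<in> carrier A" "x \<in> carrier V" for a x
    using that by (simp add: \<phi>_def linear_maps_add[OF plin] pi ps)
  have "\<phi> \<in> linear_maps K C.E E"
    by (rule linear_mapsI)
      (auto simp: \<phi>_def C.E_carrier linear_maps_add[OF ilin] linear_maps_smult[OF ilin]
        linear_maps_add[OF slin] linear_maps_smult[OF slin] E.smult_r_distr E.M.a_ac)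
  moreover have "\<phi> (u \<otimes>\<^bsub>C.E\<^esub> v) = \<phi> u \<otimes>\<^bsub>E\<^esub> \<phi> v" if uv: "u \<in> carrier C.E" "v \<in> carrier C.E" for u v
  proof -
    obtain a x b y where eq: "u = (a, x)" "v = (b, y)" by (cases u; cases v)
    then have [simp]: "a \<in> carrier A" "b \<in> carrier A" "x \<in> carrier V" "y \<in> carrier V"
      using uv by auto
    have "i (a \<otimes>\<^bsub>A\<^esub> b \<oplus>\<^bsub>A\<^esub> r (x, b) \<oplus>\<^bsub>A\<^esub> r (y, a) \<oplus>\<^bsub>A\<^esub> f (x, y)) \<oplus>\<^bsub>E\<^esub> s (x \<otimes>\<^bsub>V\<^esub> y)
      = i a \<otimes>\<^bsub>E\<^esub> i b \<oplus>\<^bsub>E\<^esub> s x \<otimes>\<^bsub>E\<^esub> i b \<oplus>\<^bsub>E\<^esub> s y \<otimes>\<^bsub>E\<^esub> i a \<oplus>\<^bsub>E\<^esub> (i (f (x, y)) \<oplus>\<^bsub>E\<^esub> s (x \<otimes>\<^bsub>V\<^esub> y))"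
      by (simp add: linear_maps_add[OF ilin] imult r E.M.a_assoc)
    also have "\<dots> = (i a \<oplus>\<^bsub>E\<^esub> s x) \<otimes>\<^bsub>E\<^esub> (i b \<oplus>\<^bsub>E\<^esub> s y)"
      using E.prod_commute[of "s y" "i a"]
      by (simp add: f_eq E.prod_add_left E.prod_add_right E.M.a_ac)
    finally show ?thesis by (simp add: eq \<phi>_def)
  qed
  ultimately have \<phi>: "\<phi> \<in> jordan_morphisms K C.E E" by (simp add: jordan_morphisms_def)
  have "inj_on \<phi> (carrier C.E)"
  proof (rule inj_onI)
    fix u v assume uv: "u \<in> carrier C.E" "v \<in> carrier C.E" "\<phi> u = \<phi> v"
    obtain a x b y where eq: "u = (a, x)" "v = (b, y)" by (cases u; cases v)
    then have mem: "a \<in> carrier A" "b \<in> carrier A" "x \<in> carrier V" "y \<in> carrier V"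
      using uv by auto
    \<comment> \<open>\<open>p\<close> recovers the \<open>V\<close>-coordinate; cancelling
      \<open>s x\<close> then leaves the injective \<open>i\<close>.\<close>
    have "x = y" using p\<phi>[of a x] p\<phi>[of b y] mem uv eq by simp
    moreover from this have "i a = i b" using uv mem by (simp add: eq \<phi>_def)
    ultimately show "u = v" using inj_onD[OF inj] mem eq by simp
  qed
  then have "jordan_algebra K C.E"
    by (rule jordan_algebra_if_embeds[OF C.comm_algebra_E extensionsD(1)[OF Sx] \<phi>])
  then have "(r, f) \<in> crossed_systems K A V"
    using r_bilin f_bilin cp1
    by (simp add: crossed_systems_def C.jordan_crossed_product_iff[OF jA jV])
  moreover have "cohomologous_ext K V A (crossed_ext A V (r, f)) S"
    using \<phi> p\<phi> linear_maps_zero[OF V.is_module E.is_module slin]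
    by (auto simp: cohomologous_ext_def crossed_ext_def SE C.E_carrier \<phi>_def intro!: bexI[of _ \<phi>])
  ultimately show thesis by (rule that)
qed

section \<open>Classes of crossed systems and classes of extensions\<close>

theorem theorem3p5:
  fixes K :: "('k, 'r) ring_scheme"
    and A :: "('k, 'a) module"
    and V :: "('k, 'v) module"
  assumes "field K"
    and "ring_characteristic K \<noteq> 2"
    and "jordan_algebra K A"
    and "jordan_algebra K V"
  shows "equiv (crossed_systems K A V) (cohomologous_systems K A V)
    \<and> equiv (extensions K V A :: ('k, 'a, 'v, 'a \<times> 'v) ext_triple set) (ext_rel K V A)
    \<and> (\<forall>c\<in>crossed_systems K A V. crossed_ext A V c \<in> extensions K V A)
    \<and> (\<exists>F. (\<forall>c\<in>crossed_systems K A V.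
               F (cohomologous_systems K A V `` {c}) = ext_rel K V A `` {crossed_ext A V c})
           \<and> bij_betw F (H2_nab K V A) (Ext K V A))
    \<and> (\<forall>S \<in> (extensions K V A :: ('k, 'a, 'v, 'e) ext_triple set).
           \<exists>!C. C \<in> Ext K V A \<and> (\<forall>T\<in>C. cohomologous_ext K V A S T))"
proof (intro conjI ballI)
  note jA = assms(3) and jV = assms(4)
  have mA: "module K A" and mV: "module K V"
    using jA jV by (auto dest: jordan_algebra_imp_comm_algebra comm_algebra.is_module)
  let ?CS = "crossed_systems K A V" and ?coh = "cohomologous_systems K A V"
  let ?X = "extensions K V A :: ('k, 'a, 'v, 'a \<times> 'v) ext_triple set"
  let ?R = "ext_rel K V A :: (('k, 'a, 'v, 'a \<times> 'v) ext_triple \<times> _) set"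
  let ?ext = "crossed_ext A V"
  note ext_mem = crossed_ext_in_extensions[OF jA jV]
  show equivX: "equiv ?X ?R" by (rule equiv_ext_rel[OF mA mV])
  \<comment> \<open>\<open>?coh\<close> is the pullback of \<open>?R\<close> along
    \<open>?ext\<close>. The equivalence laws, well-definedness and injectivity are all read off
    from this.\<close>
  have rel_iff: "(c, c') \<in> ?coh \<longleftrightarrow> c \<in> ?CS \<and> c' \<in> ?CS \<and> (?ext c, ?ext c') \<in> ?R" for c c'
  proof -
    have "c \<in> ?CS \<and> c' \<in> ?CS" if "(c, c') \<in> ?coh"
      using that by (auto simp: cohomologous_systems_def)
    then show ?thesis
      using cohomologous_systems_iff[OF jA jV, of c c'] ext_mem[of c] ext_mem[of c']
      by (auto simp: ext_rel_def)
  qed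
  show equivC: "equiv ?CS ?coh"
  proof (rule equivI)
    show "?coh \<subseteq> ?CS \<times> ?CS" by (auto simp: rel_iff)
    show "refl_on ?CS ?coh"
      using equivX ext_mem unfolding refl_on_def equiv_def rel_iff by blast
    show "sym ?coh"
      using equivX unfolding sym_def equiv_def rel_iff by blast
    show "trans ?coh"
      using equivX unfolding trans_def equiv_def rel_iff by blast
  qed
  show "?ext c \<in> ?X" if "c \<in> ?CS" for c by (rule ext_mem[OF that])
  \<comment> \<open>The union over all representatives avoids choosing one; on a class of crossed
    systems all contributions are the same class of extensions.\<close>
  define F where "F X = ?R `` (?ext ` X)" for X
  have F: "F (?coh `` {c}) = ?R `` {?ext c}" if c: "c \<in> ?CS" for c
  proof -
    have "?R `` {?ext c'} = ?R `` {?ext c}" if "(c, c') \<in> ?coh" for c'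
      using that equiv_class_eq[OF equivX, of "?ext c" "?ext c'"] by (simp add: rel_iff)
    moreover have "(c, c) \<in> ?coh" using equivC c by (simp add: equiv_def refl_on_def)
    ultimately show ?thesis unfolding F_def by blast
  qed
  have surj: "\<exists>c\<in>?CS. (?ext c, T) \<in> ?R" if T: "T \<in> ?X" for T
  proof -
    obtain c where "c \<in> ?CS" "cohomologous_ext K V A (?ext c) T"
      using extension_cohomologous_to_crossed_ext[OF jA jV T] .
    then show ?thesis using ext_mem[of c] T by (intro bexI[of _ c]) (simp_all add: ext_rel_def)
  qed
  have "inj_on F (H2_nab K V A)"
  proof (rule inj_onI)
    fix X Y assume XY: "X \<in> H2_nab K V A" "Y \<in> H2_nab K V A" "F X = F Y"
    obtain c d where cd: "c \<in> ?CS" "X = ?coh `` {c}" "d \<in> ?CS" "Y = ?coh `` {d}"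
      using XY by (auto simp: H2_nab_def elim!: quotientE)
    then have "?R `` {?ext c} = ?R `` {?ext d}" using XY F by simp
    then have "(?ext c, ?ext d) \<in> ?R"
      using eq_equiv_class[OF _ equivX] ext_mem cd by blast
    then show "X = Y" using cd equiv_class_eq[OF equivC, of c d] by (simp add: rel_iff)
  qed
  moreover have "F ` H2_nab K V A = Ext K V A"
  proof (intro equalityI subsetI)
    fix C assume "C \<in> F ` H2_nab K V A"
    then obtain c where "c \<in> ?CS" "C = F (?coh `` {c})" by (auto simp: H2_nab_def elim!: quotientE)
    then show "C \<in> Ext K V A" by (simp add: Ext_def F ext_mem quotientI)
  next
    fix C :: "('k, 'a, 'v, 'a \<times> 'v) ext_triple set" assume "C \<in> Ext K V A"
    then obtain T where T: "T \<in> ?X" "C = ?R `` {T}" by (auto simp: Ext_def elim!: quotientE)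
    then obtain c where c: "c \<in> ?CS" "(?ext c, T) \<in> ?R" using surj by blast
    then have "C = F (?coh `` {c})" using F T equiv_class_eq[OF equivX c(2)] by simp
    then show "C \<in> F ` H2_nab K V A" using c by (simp add: H2_nab_def quotientI)
  qed
  ultimately show "\<exists>F. (\<forall>c\<in>?CS. F (?coh `` {c}) = ?R `` {?ext c})
      \<and> bij_betw F (H2_nab K V A) (Ext K V A)"
    using F by (intro exI[of _ F]) (simp add: bij_betw_def)
  \<comment> \<open>Here the carrier type \<open>'e\<close> is arbitrary. That \<open>S\<close>
    determines exactly one class shows that confining \<open>Ext\<close> to the type
    \<open>'a \<times> 'v\<close> loses no extension.\<close>
  fix S assume S: "S \<in> (extensions K V A :: ('k, 'a, 'v, 'e) ext_triple set)"
  obtain c where c: "c \<in> ?CS" "cohomologous_ext K V A (?ext c) S"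
    using extension_cohomologous_to_crossed_ext[OF jA jV S] .
  have S_ext: "cohomologous_ext K V A S (?ext c)"
    by (rule cohomologous_ext_sym[OF mA mV ext_mem[OF c(1)] S c(2)])
  show "\<exists>!C. C \<in> Ext K V A \<and> (\<forall>T\<in>C. cohomologous_ext K V A S T)"
  proof (rule ex1I[of _ "?R `` {?ext c}"], intro conjI ballI)
    show "?R `` {?ext c} \<in> Ext K V A"
      using ext_mem[OF c(1)] by (auto simp: Ext_def intro: quotientI)
    show "cohomologous_ext K V A S T" if "T \<in> ?R `` {?ext c}" for T
      using that by (intro cohomologous_ext_trans[OF S_ext]) (simp add: ext_rel_def)
    fix C assume C: "C \<in> Ext K V A \<and> (\<forall>T\<in>C. cohomologous_ext K V A S T)"
    then obtain T where T: "T \<in> ?X" "C = ?R `` {T}" by (auto simp: Ext_def elim!: quotientE)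
    \<comment> \<open>Uniqueness: a representative \<open>T\<close> of any admissible class is
      linked to \<open>?ext c\<close> through \<open>S\<close>, and both live on the product type,
      so \<open>?R\<close> relates them.\<close>
    then have "T \<in> C" using equiv_class_self[OF equivX] by simp
    then have "cohomologous_ext K V A (?ext c) T"
      using C cohomologous_ext_trans[OF c(2)] by blast
    then have "(?ext c, T) \<in> ?R" using T ext_mem[OF c(1)] by (simp add: ext_rel_def)
    then show "C = ?R `` {?ext c}" using T equiv_class_eq[OF equivX] by blast
  qed
qed

end
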